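(* Let $S$ be a finite (additively written) abelian group. Set $k=|2S|$ and $r=|S/2S|$. Then $\mathfrak{g}_S/I$ is isomorphic to the direct sum of $r$ copies of simple Lie algebras of type $B_{\frac12(k-1)}$ if $k$ is odd and of type $D_{\frac12 k}$ if $k$ is even, where $\mathfrak{g}_S$ and its ideal $I$ are as defined in the context.
   Context: All Lie algebras are over $\mathbb{C}$. $2S=\{2\alpha\mid\alpha\in S\}$ and $S^0=\{\alpha\in S\mid2\alpha=0\}$. $\mathfrak{g}_S$ is the Lie algebra with generators $d^{\alpha,\beta}$ ($\alpha,\beta\in S$), subject to $d^{-\alpha,\beta}=-d^{\alpha,\beta}$ and $$[d^{\alpha,\beta},d^{\mu,\nu}]=\delta_{\alpha+\mu,\nu-\beta}d^{\alpha+\mu,-\alpha+\nu}-\delta_{\alpha+\mu,\beta-\nu}d^{\alpha+\mu,\alpha+\nu}-\delta_{\alpha-\mu,\nu-\beta}d^{\alpha-\mu,\nu-\alpha}+\delta_{\alpha-\mu,\beta-\nu}d^{\alpha-\mu,\alpha+\nu}$$ for $\alpha,\beta,\mu,\nu\in S$. $I=\mathrm{span}\{d^{\alpha+\gamma,\beta+\gamma}-d^{\alpha,\beta}\mid\alpha,\beta\in S,\ \gamma\in S^0\}\subset\mathfrak{g}_S$, which is an ideal of $\mathfrak{g}_S$.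
   Formalization: The isomorphism is proved for all k, with B_l and D_l read as so_{2l+1} and so_{2l}; the summands are claimed to be simple only for k different from 1, 2 and 4, since B_0 = 0, D_1 is abelian and D_2 = A_1 + A_1 is not simple. *)

theory Defs
  imports "Jordan_Normal_Form.VS_Connect" "HOL-Algebra.QuotRing"
begin

section \<open>Complex Lie algebras\<close>

text \<open>
  A Lie algebra is a complex vector space in the sense of HOL-Algebra whose field \<open>mult\<close>
  holds the bracket. The field \<open>one\<close> of the underlying record has no meaning for a Lie algebra
  and is left undefined in all constructions below.
\<close>

type_synonym 'a lie = "(complex, 'a) module"

locale lie_algebra = vectorspace class_ring L for L :: "'a lie" (structure) +
  assumes bracket_closed: "x \<in> carrier L \<Longrightarrow> y \<in> carrier L \<Longrightarrow> x \<otimes> y \<in> carrier L"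
    and bracket_add_left: "x \<in> carrier L \<Longrightarrow> y \<in> carrier L \<Longrightarrow> z \<in> carrier L \<Longrightarrow>
      (x \<oplus> y) \<otimes> z = x \<otimes> z \<oplus> y \<otimes> z"
    and bracket_add_right: "x \<in> carrier L \<Longrightarrow> y \<in> carrier L \<Longrightarrow> z \<in> carrier L \<Longrightarrow>
      x \<otimes> (y \<oplus> z) = x \<otimes> y \<oplus> x \<otimes> z"
    and bracket_smult_left: "x \<in> carrier L \<Longrightarrow> y \<in> carrier L \<Longrightarrow> (c \<odot> x) \<otimes> y = c \<odot> (x \<otimes> y)"
    and bracket_smult_right: "x \<in> carrier L \<Longrightarrow> y \<in> carrier L \<Longrightarrow> x \<otimes> (c \<odot> y) = c \<odot> (x \<otimes> y)"
    and bracket_alternating: "x \<in> carrier L \<Longrightarrow> x \<otimes> x = \<zero>"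
    and jacobi: "x \<in> carrier L \<Longrightarrow> y \<in> carrier L \<Longrightarrow> z \<in> carrier L \<Longrightarrow>
      x \<otimes> (y \<otimes> z) \<oplus> (y \<otimes> (z \<otimes> x) \<oplus> z \<otimes> (x \<otimes> y)) = \<zero>"

definition lie_ideal :: "'a set \<Rightarrow> 'a lie \<Rightarrow> bool" where
  "lie_ideal I L \<longleftrightarrow> LinearCombinations.submodule class_ring I L \<and>
     (\<forall>x\<in>carrier L. \<forall>y\<in>I. x \<otimes>\<^bsub>L\<^esub> y \<in> I)"

definition lie_simple :: "'a lie \<Rightarrow> bool" where
  "lie_simple L \<longleftrightarrow> lie_algebra L \<and>
     (\<exists>x\<in>carrier L. \<exists>y\<in>carrier L. x \<otimes>\<^bsub>L\<^esub> y \<noteq> \<zero>\<^bsub>L\<^esub>) \<and>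
     (\<forall>I. lie_ideal I L \<longrightarrow> I = {\<zero>\<^bsub>L\<^esub>} \<or> I = carrier L)"

definition lie_iso :: "'a lie \<Rightarrow> 'b lie \<Rightarrow> ('a \<Rightarrow> 'b) set" where
  "lie_iso L M = {f \<in> LinearCombinations.module_hom class_ring L M. bij_betw f (carrier L) (carrier M) \<and>
     (\<forall>x\<in>carrier L. \<forall>y\<in>carrier L. f (x \<otimes>\<^bsub>L\<^esub> y) = f x \<otimes>\<^bsub>M\<^esub> f y)}"

definition lie_isomorphic :: "'a lie \<Rightarrow> 'b lie \<Rightarrow> bool" where
  "lie_isomorphic L M \<longleftrightarrow> lie_algebra L \<and> lie_algebra M \<and> lie_iso L M \<noteq> {}"

definition lie_quot :: "'a lie \<Rightarrow> 'a set \<Rightarrow> 'a set lie" where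
  "lie_quot L I = \<lparr>carrier = a_rcosets\<^bsub>L\<^esub> I, mult = rcoset_mult L I, one = undefined, zero = I,
     add = set_add L, smult = (\<lambda>c A. \<Union>x\<in>A. I +>\<^bsub>L\<^esub> (c \<odot>\<^bsub>L\<^esub> x))\<rparr>"

text \<open>The (external) direct sum of \<open>r\<close> copies of a Lie algebra.\<close>

definition lie_copies :: "nat \<Rightarrow> 'a lie \<Rightarrow> (nat \<Rightarrow> 'a) lie" where
  "lie_copies r L = \<lparr>carrier = {..<r} \<rightarrow>\<^sub>E carrier L,
     mult = (\<lambda>f g. \<lambda>i\<in>{..<r}. f i \<otimes>\<^bsub>L\<^esub> g i), one = undefined, zero = (\<lambda>i\<in>{..<r}. \<zero>\<^bsub>L\<^esub>),
     add = (\<lambda>f g. \<lambda>i\<in>{..<r}. f i \<oplus>\<^bsub>L\<^esub> g i), smult = (\<lambda>c f. \<lambda>i\<in>{..<r}. c \<odot>\<^bsub>L\<^esub> f i)\<rparr>"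


section \<open>The orthogonal Lie algebras\<close>

definition so :: "nat \<Rightarrow> complex mat lie" where
  "so n = \<lparr>carrier = {A \<in> carrier_mat n n. A\<^sup>T = - A}, mult = (\<lambda>A B. A * B - B * A),
     one = undefined, zero = 0\<^sub>m n n, add = (+), smult = (\<cdot>\<^sub>m)\<rparr>"

text \<open>
  The usual conventions for small ranks are in force: type \<open>B\<^sub>0\<close> is the zero algebra, \<open>D\<^sub>1\<close> the
  one-dimensional abelian algebra and \<open>D\<^sub>2\<close> the sum of two copies of \<open>A\<^sub>1\<close>; for all other
  \<open>l \<ge> 1\<close> these are simple.
\<close>

definition type_B :: "nat \<Rightarrow> complex mat lie" where "type_B l = so (2 * l + 1)"
definition type_D :: "nat \<Rightarrow> complex mat lie" where "type_D l = so (2 * l)"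


section \<open>Lie algebras given by generators and relations\<close>

datatype 'g lie_term =
    Gen 'g
  | Zero
  | Add "'g lie_term" "'g lie_term"
  | Scale complex "'g lie_term"
  | Bracket "'g lie_term" "'g lie_term"

text \<open>
  Two terms are identified iff their equality follows from the relations \<open>R\<close> and the axioms of
  a complex Lie algebra, so the quotient is the free Lie algebra modulo the ideal generated
  by \<open>R\<close>.
\<close>

inductive_set lie_cong :: "('g lie_term \<times> 'g lie_term) set \<Rightarrow> ('g lie_term \<times> 'g lie_term) set"
  for R where
  relation: "p \<in> R \<Longrightarrow> p \<in> lie_cong R"
| refl: "(s, s) \<in> lie_cong R"
| sym: "(s, t) \<in> lie_cong R \<Longrightarrow> (t, s) \<in> lie_cong R"
| trans: "(s, t) \<in> lie_cong R \<Longrightarrow> (t, u) \<in> lie_cong R \<Longrightarrow> (s, u) \<in> lie_cong R"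
| Add: "(s, s') \<in> lie_cong R \<Longrightarrow> (t, t') \<in> lie_cong R \<Longrightarrow> (Add s t, Add s' t') \<in> lie_cong R"
| Scale: "(s, s') \<in> lie_cong R \<Longrightarrow> (Scale c s, Scale c s') \<in> lie_cong R"
| Bracket: "(s, s') \<in> lie_cong R \<Longrightarrow> (t, t') \<in> lie_cong R \<Longrightarrow>
    (Bracket s t, Bracket s' t') \<in> lie_cong R"
| add_assoc: "(Add (Add s t) u, Add s (Add t u)) \<in> lie_cong R"
| add_commute: "(Add s t, Add t s) \<in> lie_cong R"
| add_zero: "(Add Zero s, s) \<in> lie_cong R"
| add_inverse: "(Add (Scale (-1) s) s, Zero) \<in> lie_cong R"
| scale_add_right: "(Scale c (Add s t), Add (Scale c s) (Scale c t)) \<in> lie_cong R"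
| scale_add_left: "(Scale (b + c) s, Add (Scale b s) (Scale c s)) \<in> lie_cong R"
| scale_scale: "(Scale (b * c) s, Scale b (Scale c s)) \<in> lie_cong R"
| scale_one: "(Scale 1 s, s) \<in> lie_cong R"
| bracket_add_left: "(Bracket (Add s t) u, Add (Bracket s u) (Bracket t u)) \<in> lie_cong R"
| bracket_add_right: "(Bracket s (Add t u), Add (Bracket s t) (Bracket s u)) \<in> lie_cong R"
| bracket_scale_left: "(Bracket (Scale c s) t, Scale c (Bracket s t)) \<in> lie_cong R"
| bracket_scale_right: "(Bracket s (Scale c t), Scale c (Bracket s t)) \<in> lie_cong R"
| bracket_alternating: "(Bracket s s, Zero) \<in> lie_cong R"
| jacobi: "(Add (Bracket s (Bracket t u)) (Add (Bracket t (Bracket u s)) (Bracket u (Bracket s t))),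
    Zero) \<in> lie_cong R"

definition lie_class :: "('g lie_term \<times> 'g lie_term) set \<Rightarrow> 'g lie_term \<Rightarrow> 'g lie_term set" where
  "lie_class R t = lie_cong R `` {t}"

definition lie_presented :: "('g lie_term \<times> 'g lie_term) set \<Rightarrow> 'g lie_term set lie" where
  "lie_presented R = \<lparr>carrier = UNIV // lie_cong R,
     mult = (\<lambda>A B. \<Union>s\<in>A. \<Union>t\<in>B. lie_class R (Bracket s t)), one = undefined,
     zero = lie_class R Zero,
     add = (\<lambda>A B. \<Union>s\<in>A. \<Union>t\<in>B. lie_class R (Add s t)),
     smult = (\<lambda>c A. \<Union>s\<in>A. lie_class R (Scale c s))\<rparr>"


section \<open>The Lie algebra attached to an abelian group\<close>

text \<open>The group \<open>S\<close> is the type \<open>'s\<close>; \<open>D \<alpha> \<beta>\<close> is the generator \<open>d\<^sup>\<alpha>\<^sup>,\<^sup>\<beta>\<close> as a formal term.\<close>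

abbreviation D :: "'s \<Rightarrow> 's \<Rightarrow> ('s \<times> 's) lie_term" where "D \<alpha> \<beta> \<equiv> Gen (\<alpha>, \<beta>)"

definition gS_relations :: "(('s::ab_group_add \<times> 's) lie_term \<times> ('s \<times> 's) lie_term) set" where
  "gS_relations =
     {(D (- \<alpha>) \<beta>, Scale (-1) (D \<alpha> \<beta>)) | \<alpha> \<beta>. True} \<union>
     {(Bracket (D \<alpha> \<beta>) (D \<mu> \<nu>),
       Add (Scale (of_bool (\<alpha> + \<mu> = \<nu> - \<beta>)) (D (\<alpha> + \<mu>) (- \<alpha> + \<nu>)))
      (Add (Scale (- of_bool (\<alpha> + \<mu> = \<beta> - \<nu>)) (D (\<alpha> + \<mu>) (\<alpha> + \<nu>)))
      (Add (Scale (- of_bool (\<alpha> - \<mu> = \<nu> - \<beta>)) (D (\<alpha> - \<mu>) (\<nu> - \<alpha>)))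
           (Scale (of_bool (\<alpha> - \<mu> = \<beta> - \<nu>)) (D (\<alpha> - \<mu>) (\<alpha> + \<nu>)))))) | \<alpha> \<beta> \<mu> \<nu>. True}"

definition gS :: "('s::ab_group_add \<times> 's) lie_term set lie" where
  "gS = lie_presented gS_relations"

definition gS_gen :: "'s::ab_group_add \<Rightarrow> 's \<Rightarrow> ('s \<times> 's) lie_term set" where
  "gS_gen \<alpha> \<beta> = lie_class gS_relations (D \<alpha> \<beta>)"

definition gS_ideal :: "('s::ab_group_add \<times> 's) lie_term set set" where
  "gS_ideal = LinearCombinations.module.span class_ring gS
     {gS_gen (\<alpha> + \<gamma>) (\<beta> + \<gamma>) \<ominus>\<^bsub>gS\<^esub> gS_gen \<alpha> \<beta> | \<alpha> \<beta> \<gamma>. \<gamma> + \<gamma> = 0}"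

definition double_subgroup :: "'s::ab_group_add set" where
  "double_subgroup = range (\<lambda>\<alpha>. \<alpha> + \<alpha>)"

definition double_cosets :: "'s::ab_group_add set set" where
  "double_cosets = range (\<lambda>\<alpha>. (+) \<alpha> ` double_subgroup)"

end

theory Submission
  imports Defs
begin

text \<open>
  Put \<open>p = \<beta> - \<alpha>\<close> and \<open>q = \<alpha> + \<beta>\<close>. Then \<open>p\<close> and \<open>q\<close> lie in the same coset of \<open>2S\<close>, the pair \<open>(p, q)\<close>
  determines \<open>(\<alpha>, \<beta>)\<close> up to a common shift by \<open>S\<^sup>0\<close>, and the defining relations of \<open>d\<^sup>\<alpha>\<^sup>,\<^sup>\<beta>\<close> are exactly
  those of the skew-symmetric matrices \<open>E\<^sub>p\<^sub>q - E\<^sub>q\<^sub>p\<close>. Numbering the cosets and the elements of each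
  coset therefore gives a surjective homomorphism from \<open>\<gg>\<^sub>S\<close> onto \<open>r\<close> copies of \<open>so k\<close> that kills the
  ideal. Sending \<open>E\<^sub>p\<^sub>q - E\<^sub>q\<^sub>p\<close> back to a generator is a linear section; modulo the ideal it inverts the
  homomorphism on generators, which span \<open>\<gg>\<^sub>S\<close>, so the kernel is the ideal.

  Simplicity of \<open>so n\<close>: the operators \<open>- (ad (E\<^sub>i\<^sub>j - E\<^sub>j\<^sub>i))\<^sup>2\<close> preserve every ideal and are coordinate
  projections. For \<open>n = 3\<close> or \<open>n \<ge> 5\<close> a product of them isolates any single coordinate, so a nonzero
  ideal contains some \<open>E\<^sub>a\<^sub>b - E\<^sub>b\<^sub>a\<close>, and brackets then produce all the others.
\<close>

section \<open>Lie algebras, quotients and direct sums\<close>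

text \<open>Apart from closure, the hypotheses are the axioms built into \<open>lie_cong\<close>,
  with the additive inverse given as scaling by -1. So a presented algebra can be checked
  constructor by constructor.\<close>

lemma lie_algebraI:
  fixes L :: "'a lie" (structure)
  assumes "\<zero> \<in> carrier L"
    and "\<And>x y. x \<in> carrier L \<Longrightarrow> y \<in> carrier L \<Longrightarrow> x \<oplus> y \<in> carrier L"
    and "\<And>c x. x \<in> carrier L \<Longrightarrow> c \<odot> x \<in> carrier L"
    and "\<And>x y. x \<in> carrier L \<Longrightarrow> y \<in> carrier L \<Longrightarrow> x \<otimes> y \<in> carrier L"
    and "\<And>x y. x \<in> carrier L \<Longrightarrow> y \<in> carrier L \<Longrightarrow> x \<oplus> y = y \<oplus> x"
    and "\<And>x y z. x \<in> carrier L \<Longrightarrow> y \<in> carrier L \<Longrightarrow> z \<in> carrier L \<Longrightarrow> (x \<oplus> y) \<oplus> z = x \<oplus> (y \<oplus> z)"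
    and "\<And>x. x \<in> carrier L \<Longrightarrow> \<zero> \<oplus> x = x"
    and "\<And>x. x \<in> carrier L \<Longrightarrow> ((-1) \<odot> x) \<oplus> x = \<zero>"
    and "\<And>c x y. x \<in> carrier L \<Longrightarrow> y \<in> carrier L \<Longrightarrow> c \<odot> (x \<oplus> y) = c \<odot> x \<oplus> c \<odot> y"
    and "\<And>b c x. x \<in> carrier L \<Longrightarrow> (b + c) \<odot> x = b \<odot> x \<oplus> c \<odot> x"
    and "\<And>b c x. x \<in> carrier L \<Longrightarrow> (b * c) \<odot> x = b \<odot> (c \<odot> x)"
    and "\<And>x. x \<in> carrier L \<Longrightarrow> 1 \<odot> x = x"
    and "\<And>x y z. x \<in> carrier L \<Longrightarrow> y \<in> carrier L \<Longrightarrow> z \<in> carrier L \<Longrightarrow> (x \<oplus> y) \<otimes> z = x \<otimes> z \<oplus> y \<otimes> z"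
    and "\<And>x y z. x \<in> carrier L \<Longrightarrow> y \<in> carrier L \<Longrightarrow> z \<in> carrier L \<Longrightarrow> x \<otimes> (y \<oplus> z) = x \<otimes> y \<oplus> x \<otimes> z"
    and "\<And>c x y. x \<in> carrier L \<Longrightarrow> y \<in> carrier L \<Longrightarrow> (c \<odot> x) \<otimes> y = c \<odot> (x \<otimes> y)"
    and "\<And>c x y. x \<in> carrier L \<Longrightarrow> y \<in> carrier L \<Longrightarrow> x \<otimes> (c \<odot> y) = c \<odot> (x \<otimes> y)"
    and "\<And>x. x \<in> carrier L \<Longrightarrow> x \<otimes> x = \<zero>"
    and "\<And>x y z. x \<in> carrier L \<Longrightarrow> y \<in> carrier L \<Longrightarrow> z \<in> carrier L \<Longrightarrow>
      x \<otimes> (y \<otimes> z) \<oplus> (y \<otimes> (z \<otimes> x) \<oplus> z \<otimes> (x \<otimes> y)) = \<zero>"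
  shows "lie_algebra L"
proof -
  have "abelian_group L"
  proof (rule abelian_groupI)
    show "\<exists>y\<in>carrier L. y \<oplus> x = \<zero>" if "x \<in> carrier L" for x
      by (rule bexI[of _ "(-1) \<odot> x"]) (use that in \<open>metis assms\<close>, simp add: assms that)
  qed (fact assms)+
  then have "module class_ring L"
    by (intro moduleI class_cring.is_cring) (simp_all add: assms)
  then show ?thesis
    by (intro lie_algebra.intro vectorspace.intro class_field lie_algebra_axioms.intro) (simp_all add: assms)
qed

context lie_algebra
begin

lemma scale_closed [simp]: "x \<in> carrier L \<Longrightarrow> c \<odot> x \<in> carrier L"
  by (simp add: smult_closed)

lemma scale_zero [simp]: "x \<in> carrier L \<Longrightarrow> 0 \<odot> x = \<zero>"
  using smult_l_null[of x] by simp

lemma scale_zero_right [simp]: "c \<odot> \<zero> = \<zero>"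
  using smult_r_null[of c] by simp

lemma scale_one [simp]: "x \<in> carrier L \<Longrightarrow> 1 \<odot> x = x"
  using smult_one[of x] by simp

lemma scale_add_left: "x \<in> carrier L \<Longrightarrow> (b + c) \<odot> x = b \<odot> x \<oplus> c \<odot> x"
  using smult_l_distr[of b c x] by simp

lemma scale_add_right: "x \<in> carrier L \<Longrightarrow> y \<in> carrier L \<Longrightarrow> c \<odot> (x \<oplus> y) = c \<odot> x \<oplus> c \<odot> y"
  using smult_r_distr[of c x y] by simp

lemma scale_scale: "x \<in> carrier L \<Longrightarrow> b \<odot> (c \<odot> x) = (b * c) \<odot> x"
  using smult_assoc1[of b c x] by simp

lemma scale_minus_one: "x \<in> carrier L \<Longrightarrow> (-1) \<odot> x = \<ominus> x"
  using smult_minus_1[of x] by (simp add: class_ring_simps)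

lemma bracket_zero_right [simp]: "x \<in> carrier L \<Longrightarrow> x \<otimes> \<zero> = \<zero>"
  using bracket_smult_right[of x \<zero> 0] bracket_closed[of x \<zero>] by simp

lemma bracket_zero_left [simp]: "x \<in> carrier L \<Longrightarrow> \<zero> \<otimes> x = \<zero>"
  using bracket_smult_left[of \<zero> x 0] bracket_closed[of \<zero> x] by simp

lemma bracket_anticommute:
  assumes "x \<in> carrier L" "y \<in> carrier L"
  shows "y \<otimes> x = \<ominus> (x \<otimes> y)"
proof -
  have "\<zero> = (x \<oplus> y) \<otimes> (x \<oplus> y)"
    using assms by (simp add: bracket_alternating)
  also have "\<dots> = x \<otimes> y \<oplus> y \<otimes> x"
    using assms by (simp add: bracket_closed bracket_add_left bracket_add_right bracket_alternating[of x]
      bracket_alternating[of y] a_comm)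
  finally show ?thesis
    using assms by (metis minus_equality a_comm bracket_closed)
qed

end

text \<open>The axioms are equations between terms, so they pass to the image under any map that
  respects the operations. For a quotient it therefore suffices to compute the operations on
  representatives.\<close>

lemma lie_algebra_image:
  fixes L :: "'a lie" and Q :: "'b lie"
  assumes "lie_algebra L" and car: "carrier Q = \<pi> ` carrier L"
    and zero: "\<zero>\<^bsub>Q\<^esub> = \<pi> \<zero>\<^bsub>L\<^esub>"
    and add: "\<And>x y. x \<in> carrier L \<Longrightarrow> y \<in> carrier L \<Longrightarrow> \<pi> x \<oplus>\<^bsub>Q\<^esub> \<pi> y = \<pi> (x \<oplus>\<^bsub>L\<^esub> y)"
    and smult: "\<And>c x. x \<in> carrier L \<Longrightarrow> c \<odot>\<^bsub>Q\<^esub> \<pi> x = \<pi> (c \<odot>\<^bsub>L\<^esub> x)"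
    and mult: "\<And>x y. x \<in> carrier L \<Longrightarrow> y \<in> carrier L \<Longrightarrow> \<pi> x \<otimes>\<^bsub>Q\<^esub> \<pi> y = \<pi> (x \<otimes>\<^bsub>L\<^esub> y)"
  shows "lie_algebra Q"
proof -
  interpret L: lie_algebra L by fact
  note ops = zero add smult mult L.bracket_closed
  show ?thesis
    by (rule lie_algebraI)
      (auto simp: car ops L.scale_minus_one L.l_neg L.r_neg L.a_ac L.bracket_add_left L.bracket_add_right L.bracket_smult_left
        L.bracket_smult_right L.bracket_alternating L.jacobi L.scale_scale
        L.scale_add_left L.scale_add_right)
qed

lemma lie_algebra_copies:
  assumes "lie_algebra L"
  shows "lie_algebra (lie_copies r L)"
proof -
  interpret L: lie_algebra L by fact
  have restrict_eq_iff: "(\<lambda>i\<in>{..<r}. f i) = g \<longleftrightarrow> (\<forall>i<r. f i = g i)"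
    if "g \<in> extensional {..<r}" for f g :: "nat \<Rightarrow> 'a"
    using that by (auto simp: fun_eq_iff extensional_def restrict_def)
  show ?thesis
    by (rule lie_algebraI)
      (auto simp: lie_copies_def PiE_iff L.scale_minus_one L.l_neg L.bracket_closed
        L.bracket_add_left L.bracket_add_right
        L.bracket_smult_left L.bracket_smult_right L.bracket_alternating L.jacobi L.scale_scale
        L.scale_add_left L.scale_add_right restrict_eq_iff
        intro!: restrict_ext intro: L.a_ac)
qed

section \<open>Quotients by ideals and the first isomorphism theorem\<close>

context
  fixes L :: "'a lie" (structure) and I
  assumes L: "lie_algebra L" and I: "lie_ideal I L"
begin

interpretation lie_algebra L by (rule L)

lemma lie_ideal_submodule: "submodule class_ring I L"
  using I by (simp add: lie_ideal_def)

text \<open>Gives access to the coset theory of abelian subgroups; closure under inverses comes from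
  scaling by -1.\<close>

lemma lie_ideal_abelian_subgroup: "abelian_subgroup I L"
proof (rule abelian_subgroupI3)
  interpret I: submodule class_ring I L by (rule lie_ideal_submodule)
  show "abelian_group L" by (rule abelian_group_axioms)
  show "additive_subgroup I L"
  proof (rule additive_subgroup.intro, rule add.subgroupI)
    show "I \<subseteq> carrier L" by (rule I.subset)
    show "I \<noteq> {}" using I.zero_closed by blast
    show "\<ominus> a \<in> I" if "a \<in> I" for a
      using I.smult_closed[of "-1" a] that I.subset scale_minus_one[of a] by (metis UNIV_I partial_object.select_convs(1) subsetD)
  qed (use I.m_closed in auto)
qed

text \<open>\<open>lie_ideal\<close> asks only for brackets with the ideal element on the right;
  anticommutativity supplies the other side.\<close>

lemma lie_ideal_bracket:
  assumes "x \<in> carrier L" "y \<in> I"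
  shows "x \<otimes> y \<in> I" "y \<otimes> x \<in> I"
proof -
  interpret I: submodule class_ring I L by (rule lie_ideal_submodule)
  show *: "x \<otimes> y \<in> I" using I assms by (simp add: lie_ideal_def)
  have y: "y \<in> carrier L" using assms I.subset by blast
  have "y \<otimes> x = (-1) \<odot> (x \<otimes> y)"
    using assms y by (simp add: bracket_anticommute[of x y] scale_minus_one bracket_closed)
  then show "y \<otimes> x \<in> I" using * I.smult_closed[of "-1"] by simp
qed

interpretation I: abelian_subgroup I L by (rule lie_ideal_abelian_subgroup)

lemma carrier_lie_quot: "carrier (lie_quot L I) = (\<lambda>x. I +> x) ` carrier L"
  by (auto simp: lie_quot_def A_RCOSETS_def')

lemma zero_lie_quot: "\<zero>\<^bsub>lie_quot L I\<^esub> = I +> \<zero>"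
  using I.a_rcos_const[of \<zero>] by (simp add: lie_quot_def)

lemma rcos_eq:
  assumes "x \<in> carrier L" "y \<in> carrier L"
  shows "I +> x = I +> y \<longleftrightarrow> x \<ominus> y \<in> I"
proof
  assume "I +> x = I +> y"
  then have "x \<in> I +> y" using I.a_rcos_self[OF assms(1)] by simp
  then show "x \<ominus> y \<in> I"
    using I.a_rcos_module[OF assms(2,1)] by (simp add: a_minus_def)
next
  assume "x \<ominus> y \<in> I"
  then have "x \<in> I +> y"
    using I.a_rcos_module[OF assms(2,1)] by (simp add: a_minus_def)
  then show "I +> x = I +> y" using I.a_repr_independence'[OF _ assms(2)] by metis
qed

lemma add_lie_quot:
  assumes "x \<in> carrier L" "y \<in> carrier L"
  shows "(I +> x) \<oplus>\<^bsub>lie_quot L I\<^esub> (I +> y) = I +> (x \<oplus> y)"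
  using assms by (simp add: lie_quot_def I.a_rcos_sum)

lemma rcosE:
  assumes "x \<in> carrier L" "x' \<in> I +> x"
  obtains a where "a \<in> I" "a \<in> carrier L" "x' = a \<oplus> x" 
  using assms I.a_subset by (auto simp: a_r_coset_def')

text \<open>\<open>lie_quot\<close> scales a coset by a union over all representatives. Changing the
  representative by \<open>a\<close> in \<open>I\<close> changes the result by a multiple of
  \<open>a\<close>, so the union consists of a single coset.\<close>

lemma smult_lie_quot:
  assumes x: "x \<in> carrier L"
  shows "c \<odot>\<^bsub>lie_quot L I\<^esub> (I +> x) = I +> (c \<odot> x)"
proof -
  interpret I': submodule class_ring I L by (rule lie_ideal_submodule)
  have *: "I +> (c \<odot> x') = I +> (c \<odot> x)" if "x' \<in> I +> x" for x'
  proof -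
    obtain a where a: "a \<in> I" "a \<in> carrier L" "x' = a \<oplus> x" by (rule rcosE[OF x \<open>x' \<in> I +> x\<close>])
    have "c \<odot> x' \<ominus> c \<odot> x = c \<odot> a"
      using a x smult_closed[of c] by (simp add: scale_add_right a_minus_def a_assoc r_neg)
    moreover have "c \<odot> a \<in> I" "c \<odot> x' \<in> carrier L" "c \<odot> x \<in> carrier L"
      using a x I'.smult_closed[of c a] smult_closed[of c] by auto
    ultimately show ?thesis by (metis rcos_eq)
  qed
  have "(\<Union>x'\<in>I +> x. I +> (c \<odot> x')) = I +> (c \<odot> x)"
    by (rule UN_constant_eq[OF I.a_rcos_self[OF x]]) (intro ballI *)
  then show ?thesis by (simp only: lie_quot_def module.simps)
qed

text \<open>Changing both representatives by \<open>a\<close> and \<open>b\<close> in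
  \<open>I\<close> changes the bracket by
  \<open>a \<otimes> b \<oplus> a \<otimes> y \<oplus> x \<otimes> b\<close>, which lies in
  \<open>I\<close> because \<open>I\<close> absorbs brackets on both sides.\<close>

lemma mult_lie_quot:
  assumes x: "x \<in> carrier L" and y: "y \<in> carrier L"
  shows "(I +> x) \<otimes>\<^bsub>lie_quot L I\<^esub> (I +> y) = I +> (x \<otimes> y)"
proof -
  interpret I': submodule class_ring I L by (rule lie_ideal_submodule)
  have *: "I +> (x' \<otimes> y') = I +> (x \<otimes> y)" if x': "x' \<in> I +> x" and y': "y' \<in> I +> y" for x' y'
  proof -
    obtain a where a: "a \<in> I" "a \<in> carrier L" "x' = a \<oplus> x" by (rule rcosE[OF x x'])
    obtain b where b: "b \<in> I" "b \<in> carrier L" "y' = b \<oplus> y" by (rule rcosE[OF y y'])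
    have "x' \<otimes> y' = ((a \<otimes> b \<oplus> a \<otimes> y) \<oplus> x \<otimes> b) \<oplus> x \<otimes> y"
      using a b x y by (simp add: bracket_add_left bracket_add_right bracket_closed a_ac)
    then have "x' \<otimes> y' \<ominus> x \<otimes> y = (a \<otimes> b \<oplus> a \<otimes> y) \<oplus> x \<otimes> b"
      using a b x y by (simp add: a_minus_def bracket_closed a_assoc r_neg)
    also have "\<dots> \<in> I"
      using a b x y by (intro I'.m_closed lie_ideal_bracket)
    finally have "x' \<otimes> y' \<ominus> x \<otimes> y \<in> I" .
    moreover have "x' \<otimes> y' \<in> carrier L" "x \<otimes> y \<in> carrier L"
      using a b x y by (simp_all add: bracket_closed)
    ultimately show ?thesis by (metis rcos_eq)
  qed
  have "(\<Union>x'\<in>I +> x. \<Union>y'\<in>I +> y. I +> (x' \<otimes> y')) = I +> (x \<otimes> y)"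
    by (rule UN_constant_eq[OF I.a_rcos_self[OF x]], rule ballI,
        rule UN_constant_eq[OF I.a_rcos_self[OF y]]) (intro ballI *)
  then show ?thesis by (simp only: lie_quot_def monoid.simps rcoset_mult_def)
qed

lemma lie_algebra_quot: "lie_algebra (lie_quot L I)"
  by (rule lie_algebra_image[OF L carrier_lie_quot])
    (simp_all add: zero_lie_quot add_lie_quot smult_lie_quot mult_lie_quot)

end

text \<open>That \<open>I\<close> is an ideal follows from its being a kernel. This also settles the
  ideal property of \<open>gS_ideal\<close> once that set is recognised as a kernel.\<close>

lemma lie_first_isomorphism:
  fixes L :: "'a lie" and M :: "'b lie"
  assumes L: "lie_algebra L" and M: "lie_algebra M"
    and hom: "f \<in> LinearCombinations.module_hom class_ring L M"
    and bracket: "\<And>x y. x \<in> carrier L \<Longrightarrow> y \<in> carrier L \<Longrightarrow> f (x \<otimes>\<^bsub>L\<^esub> y) = f x \<otimes>\<^bsub>M\<^esub> f y"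
    and surj: "f ` carrier L = carrier M"
    and ker: "I = {x \<in> carrier L. f x = \<zero>\<^bsub>M\<^esub>}"
  shows "lie_isomorphic (lie_quot L I) M"
proof -
  interpret L: lie_algebra L by fact
  interpret M: lie_algebra M by fact
  interpret f: mod_hom class_ring L M f by unfold_locales (fact hom)
  have I: "lie_ideal I L"
    unfolding lie_ideal_def
  proof (intro conjI ballI)
    show "LinearCombinations.submodule class_ring I L"
      using f.ker_is_submodule by (simp add: ker f.ker_def)
    show "x \<otimes>\<^bsub>L\<^esub> y \<in> I" if "x \<in> carrier L" "y \<in> I" for x y
      using that M.bracket_zero_right[of "f x"] by (simp add: ker bracket L.bracket_closed)
  qed
  let ?Q = "lie_quot L I"
  \<comment> \<open>From left to right this makes the induced map well defined, from right to left
    injective.\<close>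
  have eq: "I +>\<^bsub>L\<^esub> x = I +>\<^bsub>L\<^esub> y \<longleftrightarrow> f x = f y" if "x \<in> carrier L" "y \<in> carrier L" for x y
  proof -
    have "I +>\<^bsub>L\<^esub> x = I +>\<^bsub>L\<^esub> y \<longleftrightarrow> f x \<ominus>\<^bsub>M\<^esub> f y = \<zero>\<^bsub>M\<^esub>"
      using that by (simp add: rcos_eq[OF L I]) (simp add: ker)
    also have "\<dots> \<longleftrightarrow> f x = f y"
      using that M.minus_equality[of "f x" "\<ominus>\<^bsub>M\<^esub> f y"] by (auto simp: a_minus_def M.r_neg)
    finally show ?thesis .
  qed
  \<comment> \<open>The induced map evaluates \<open>f\<close> at an arbitrary representative; by
    \<open>eq\<close> the choice does not matter.\<close>
  define g where "g = (\<lambda>A. f (SOME x. x \<in> carrier L \<and> A = I +>\<^bsub>L\<^esub> x))"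
  have g: "g (I +>\<^bsub>L\<^esub> x) = f x" if "x \<in> carrier L" for x
  proof -
    have "(SOME y. y \<in> carrier L \<and> I +>\<^bsub>L\<^esub> x = I +>\<^bsub>L\<^esub> y) \<in> carrier L \<and>
      I +>\<^bsub>L\<^esub> x = I +>\<^bsub>L\<^esub> (SOME y. y \<in> carrier L \<and> I +>\<^bsub>L\<^esub> x = I +>\<^bsub>L\<^esub> y)"
      by (rule someI[of _ x]) (use that in simp)
    then show ?thesis using eq that unfolding g_def by metis
  qed
  note ops = carrier_lie_quot[OF L I] add_lie_quot[OF L I] smult_lie_quot[OF L I] mult_lie_quot[OF L I]
  have "g \<in> LinearCombinations.module_hom class_ring ?Q M"
    using L.smult_closed by (auto simp: LinearCombinations.module_hom_def ops g)
  moreover have "bij_betw g (carrier ?Q) (carrier M)"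
    unfolding bij_betw_def by (auto simp: ops inj_on_def g eq image_image surj[symmetric])
  moreover have "\<forall>x\<in>carrier ?Q. \<forall>y\<in>carrier ?Q. g (x \<otimes>\<^bsub>?Q\<^esub> y) = g x \<otimes>\<^bsub>M\<^esub> g y"
    by (auto simp: ops g L.bracket_closed bracket)
  ultimately show ?thesis
    using lie_algebra_quot[OF L I] M by (auto simp: lie_isomorphic_def lie_iso_def)
qed

section \<open>The orthogonal Lie algebras\<close>

text \<open>This is E_ij - E_ji. The difference of two indicators also covers i = j, where it is the
  zero matrix.\<close>

definition skew_unit :: "nat \<Rightarrow> nat \<Rightarrow> nat \<Rightarrow> complex mat" where
  "skew_unit n i j = mat n n (\<lambda>(a, b). of_bool (a = i \<and> b = j) - of_bool (a = j \<and> b = i))"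

lemma carrier_so_iff:
  "A \<in> carrier (so n) \<longleftrightarrow> A \<in> carrier_mat n n \<and> (\<forall>i<n. \<forall>j<n. A $$ (i, j) + A $$ (j, i) = 0)"
proof -
  have "A\<^sup>T = - A \<longleftrightarrow> (\<forall>i<n. \<forall>j<n. A $$ (i, j) + A $$ (j, i) = 0)" if "A \<in> carrier_mat n n"
  proof -
    have "A\<^sup>T = - A \<longleftrightarrow> (\<forall>i<n. \<forall>j<n. A $$ (j, i) = - A $$ (i, j))"
      using that by (simp add: mat_eq_iff)
    then show ?thesis by (simp only: eq_neg_iff_add_eq_0) (metis add.commute)
  qed
  then show ?thesis by (auto simp: so_def)
qed

lemma so_skew: "A \<in> carrier (so n) \<Longrightarrow> i < n \<Longrightarrow> j < n \<Longrightarrow> A $$ (j, i) = - A $$ (i, j)"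
  by (simp add: carrier_so_iff eq_neg_iff_add_eq_0)

lemma so_carrier_mat: "A \<in> carrier (so n) \<Longrightarrow> A \<in> carrier_mat n n"
  by (simp add: so_def)

lemma lie_algebra_so: "lie_algebra (so n)"
proof -
  have closed: "A * B - B * A \<in> carrier (so n)" if "A \<in> carrier (so n)" "B \<in> carrier (so n)" for A B
  proof -
    have A: "A \<in> carrier_mat n n" "A\<^sup>T = - A" and B: "B \<in> carrier_mat n n" "B\<^sup>T = - B"
      using that by (auto simp: so_def)
    then have "(A * B - B * A)\<^sup>T = (- B) * (- A) - (- A) * (- B)"
      by (simp add: transpose_minus[of _ n n] transpose_mult[of _ n n _ n])
    also have "\<dots> = B * A - A * B"
      using A B by simp
    also have "\<dots> = - (A * B - B * A)"
      using A B by (intro eq_matI) auto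
    finally show ?thesis using A B by (simp add: so_def minus_carrier_mat[of _ n n])
  qed
  \<comment> \<open>Expansion gives twelve triple products that cancel in pairs. The entry rule for
    products is switched off, so each product stays an atom in the entrywise comparison.\<close>
  have jac: "A * (B * C - C * B) - (B * C - C * B) * A +
     (B * (C * A - A * C) - (C * A - A * C) * B + (C * (A * B - B * A) - (A * B - B * A) * C)) = 0\<^sub>m n n"
    if "A \<in> carrier_mat n n" "B \<in> carrier_mat n n" "C \<in> carrier_mat n n" for A B C :: "complex mat"
    using that
    by (simp add: mult_minus_distrib_mat[of _ n n _ n] minus_mult_distrib_mat[of _ n n _ _ n]
      assoc_mult_mat[of _ n n _ n _ n], intro eq_matI) (auto simp del: index_mult_mat(1))
  have car: "A \<in> carrier_mat n n" if "A \<in> carrier (so n)" for A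
    using that by (simp add: so_def)
  have add: "A \<oplus>\<^bsub>so n\<^esub> B \<in> carrier (so n)" if A: "A \<in> carrier (so n)" and B: "B \<in> carrier (so n)" for A B
  proof -
    have "A $$ (i, j) + B $$ (i, j) + (A $$ (j, i) + B $$ (j, i)) = 0" if "i < n" "j < n" for i j
      using so_skew[OF A that] so_skew[OF B that] by simp
    then show ?thesis
      using so_carrier_mat[OF A] so_carrier_mat[OF B] by (simp add: carrier_so_iff) (simp add: so_def)
  qed
  have scale: "c \<odot>\<^bsub>so n\<^esub> A \<in> carrier (so n)" if A: "A \<in> carrier (so n)" for c A
  proof -
    have "c * A $$ (i, j) + c * A $$ (j, i) = 0" if "i < n" "j < n" for i j
      using so_skew[OF A that] by simp
    then show ?thesis
      using so_carrier_mat[OF A] by (simp add: carrier_so_iff) (simp add: so_def)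
  qed
  show ?thesis
    apply (rule lie_algebraI)
    subgoal by (simp add: carrier_so_iff) (simp add: so_def)
    subgoal by (rule add)
    subgoal by (rule scale)
    subgoal using closed by (simp add: so_def)
    subgoal by (simp add: so_def comm_add_mat[of _ n n])
    subgoal by (simp add: so_def assoc_add_mat[of _ n n])
    subgoal by (simp add: so_def)
    subgoal by (auto simp: so_def intro!: eq_matI)
    subgoal by (simp add: so_def add_smult_distrib_left_mat[of _ n n])
    subgoal by (simp add: so_def add_smult_distrib_right_mat[of _ n n])
    subgoal by (auto simp: so_def intro!: eq_matI)
    subgoal by (auto simp: so_def intro!: eq_matI)
    subgoal by (drule car)+ (simp add: so_def add_mult_distrib_mat[of _ n n _ _ n] mult_add_distrib_mat[of _ n n _ n],
        intro eq_matI, auto simp del: index_mult_mat(1))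
    subgoal by (drule car)+ (simp add: so_def add_mult_distrib_mat[of _ n n _ _ n] mult_add_distrib_mat[of _ n n _ n],
        intro eq_matI, auto simp del: index_mult_mat(1))
    subgoal by (drule car)+ (simp add: so_def mult_smult_assoc_mat[of _ n n _ n] mult_smult_distrib[of _ n n _ n],
        intro eq_matI, auto simp del: index_mult_mat(1) simp: algebra_simps)
    subgoal by (drule car)+ (simp add: so_def mult_smult_assoc_mat[of _ n n _ n] mult_smult_distrib[of _ n n _ n],
        intro eq_matI, auto simp del: index_mult_mat(1) simp: algebra_simps)
    subgoal by (drule car)+ (auto simp: so_def)
    subgoal by (drule car)+ (simp add: so_def jac)
    done
qed

lemma skew_unit_carrier: "skew_unit n i j \<in> carrier (so n)"
proof -
  have "skew_unit n i j $$ (x, y) + skew_unit n i j $$ (y, x) = 0" if "x < n" "y < n" for x y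
    using that by (cases "x = i"; cases "y = j"; cases "x = j"; cases "y = i") (simp_all add: skew_unit_def)
  moreover have "skew_unit n i j \<in> carrier_mat n n" by (simp add: skew_unit_def)
  ultimately show ?thesis unfolding carrier_so_iff by blast
qed

lemma skew_unit_flip: "skew_unit n b a = (-1) \<odot>\<^bsub>so n\<^esub> skew_unit n a b"
  by (rule eq_matI) (auto simp: skew_unit_def so_def)

text \<open>Indicators of conjunctions are split into products, so that sums over one index
  factor.\<close>

lemma index_skew_unit:
  "x < n \<Longrightarrow> y < n \<Longrightarrow> skew_unit n i j $$ (x, y) =
    of_bool (x = i) * of_bool (y = j) - of_bool (x = j) * of_bool (y = i)"
  by (simp add: skew_unit_def of_bool_conj)

text \<open>Multiplying by E_ij on the left moves row j to row i, on the right column i to column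
  j.\<close>

lemma index_bracket_skew_unit:
  assumes "A \<in> carrier_mat n n" "i < n" "j < n" "c < n" "d < n"
  shows "(skew_unit n i j \<otimes>\<^bsub>so n\<^esub> A) $$ (c, d) =
    of_bool (c = i) * A $$ (j, d) - of_bool (c = j) * A $$ (i, d)
    - (of_bool (d = j) * A $$ (c, i) - of_bool (d = i) * A $$ (c, j))"
proof -
  \<comment> \<open>Keeps the indicators opaque while the summands are rearranged by plain algebra;
    \<open>E_def\<close> is unfolded only when the sums collapse.\<close>
  define E :: "nat \<Rightarrow> nat \<Rightarrow> complex" where "E x y = of_bool (x = y)" for x y
  have E: "of_bool (x = y) = E x y" for x y by (simp add: E_def)
  have dims: "dim_row (skew_unit n i j) = n" "dim_col (skew_unit n i j) = n" by (simp_all add: skew_unit_def)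
  have "(skew_unit n i j * A) $$ (c, d) = (\<Sum>k<n. skew_unit n i j $$ (c, k) * A $$ (k, d))"
    using assms by (simp add: scalar_prod_def atLeast0LessThan dims)
  also have "\<dots> = (\<Sum>k<n. E c i * (E k j * A $$ (k, d)) - E c j * (E k i * A $$ (k, d)))"
    using assms by (intro sum.cong) (simp_all add: index_skew_unit E algebra_simps)
  also have "\<dots> = of_bool (c = i) * A $$ (j, d) - of_bool (c = j) * A $$ (i, d)"
    using assms by (simp add: sum_subtractf E_def flip: sum_distrib_left)
  finally have 1: "(skew_unit n i j * A) $$ (c, d) = of_bool (c = i) * A $$ (j, d) - of_bool (c = j) * A $$ (i, d)" .
  have "(A * skew_unit n i j) $$ (c, d) = (\<Sum>k<n. A $$ (c, k) * skew_unit n i j $$ (k, d))"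
    using assms by (simp add: scalar_prod_def atLeast0LessThan dims)
  also have "\<dots> = (\<Sum>k<n. E d j * (E k i * A $$ (c, k)) - E d i * (E k j * A $$ (c, k)))"
    using assms by (intro sum.cong) (simp_all add: index_skew_unit E algebra_simps)
  also have "\<dots> = of_bool (d = j) * A $$ (c, i) - of_bool (d = i) * A $$ (c, j)"
    using assms by (simp add: sum_subtractf E_def flip: sum_distrib_left)
  finally show ?thesis
    using assms 1 by (simp add: so_def skew_unit_def)
qed

text \<open>The structure constants of \<open>so n\<close>. With the right-hand side spelled out by
  entries, each use reduces to an identity between numbers.\<close>

lemma bracket_skew_unit_skew_unit:
  assumes "p < n" "q < n" "u < n" "v < n"
  shows "skew_unit n p q \<otimes>\<^bsub>so n\<^esub> skew_unit n u v =
    mat n n (\<lambda>(a, b). of_bool (p = v) * skew_unit n q u $$ (a, b) - of_bool (p = u) * skew_unit n q v $$ (a, b)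
      + of_bool (q = u) * skew_unit n p v $$ (a, b) - of_bool (q = v) * skew_unit n p u $$ (a, b))" (is "?l = ?r")
proof (rule eq_matI)
  have c: "skew_unit n u v \<in> carrier_mat n n" by (simp add: skew_unit_def)
  \<comment> \<open>hides the equations from the simplifier, leaving a polynomial identity\<close>
  define E :: "nat \<Rightarrow> nat \<Rightarrow> complex" where "E x y = of_bool (x = y)" for x y
  have E: "of_bool (x = y) = E x y" for x y by (simp add: E_def)
  show "?l $$ (c, d) = ?r $$ (c, d)" if "c < dim_row ?r" "d < dim_col ?r" for c d
    using that assms by (simp add: index_bracket_skew_unit[OF c] index_skew_unit E) (simp add: algebra_simps)
qed (simp_all add: so_def skew_unit_def)

text \<open>The matrices \<open>skew_unit n i j\<close> span: a skew matrix is the sum of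
  \<open>A $$ (i, j) / 2\<close> times \<open>skew_unit n i j\<close> over all ordered pairs. The
  factor 1/2 is there because (i, j) and (j, i) contribute the same matrix.\<close>

lemma so_submodule_eqI:
  assumes N: "LinearCombinations.submodule class_ring N (so n)"
    and unit: "\<And>i j. i < n \<Longrightarrow> j < n \<Longrightarrow> skew_unit n i j \<in> N"
  shows "carrier (so n) \<subseteq> N"
proof
  interpret N: LinearCombinations.submodule class_ring N "so n" by (rule N)
  fix A assume A: "A \<in> carrier (so n)"
  define h where "h p = A $$ p / 2" for p
  \<comment> \<open>The partial sum over a set \<open>P\<close> of positions, as a plain matrix;
    membership in \<open>N\<close> follows by induction on \<open>P\<close>.\<close>
  define S where "S P = mat n n (\<lambda>(a, b). \<Sum>(i, j)\<in>P. h (i, j) * skew_unit n i j $$ (a, b))" for P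
  have "finite P \<Longrightarrow> P \<subseteq> {..<n} \<times> {..<n} \<Longrightarrow> S P \<in> N" for P
  proof (induction P rule: finite_induct)
    case empty
    have "S {} = \<zero>\<^bsub>so n\<^esub>" by (auto simp: S_def so_def)
    then show ?case using N.zero_closed by simp
  next
    case (insert p P)
    have "S (insert p P) = h p \<odot>\<^bsub>so n\<^esub> skew_unit n (fst p) (snd p) \<oplus>\<^bsub>so n\<^esub> S P"
      using insert by (auto simp: S_def so_def skew_unit_def case_prod_beta)
    moreover have "skew_unit n (fst p) (snd p) \<in> N" "S P \<in> N"
      using insert unit by auto
    ultimately show ?case using N.smult_closed N.m_closed by simp
  qed
  from this[of "{..<n} \<times> {..<n}"] have "S ({..<n} \<times> {..<n}) \<in> N" by simp
  moreover have "S ({..<n} \<times> {..<n}) = A"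
  proof (rule eq_matI)
    fix a b assume "a < dim_row A" "b < dim_col A"
    then have ab: "a < n" "b < n" using so_carrier_mat[OF A] by auto
    have "S ({..<n} \<times> {..<n}) $$ (a, b) =
      (\<Sum>i<n. \<Sum>j<n. of_bool (a = i) * (of_bool (b = j) * h (i, j)) - of_bool (b = i) * (of_bool (a = j) * h (i, j)))"
      using ab by (simp add: S_def index_skew_unit sum.cartesian_product)
        (intro sum.cong, auto simp: algebra_simps)
    also have "\<dots> = h (a, b) - h (b, a)"
      using ab by (simp add: sum_subtractf flip: sum_distrib_left)
    also have "\<dots> = A $$ (a, b)" using so_skew[OF A ab] by (simp add: h_def)
    finally show "S ({..<n} \<times> {..<n}) $$ (a, b) = A $$ (a, b)" .
  qed (use so_carrier_mat[OF A] in \<open>auto simp: S_def\<close>)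
  ultimately show "A \<in> N" by simp
qed

section \<open>Simplicity of the orthogonal Lie algebras\<close>

text \<open>On entries with exactly one index in {i, j}, bracketing with
  \<open>skew_unit n i j\<close> is a quarter turn of rows or columns i and j, with square -1.
  Entries with no index in {i, j} are killed. The block on {i, j} is killed too: there the skew
  matrix \<open>A\<close> is a multiple of \<open>skew_unit n i j\<close>.\<close>

lemma index_bracket_bracket_skew_unit:
  assumes A: "A \<in> carrier (so n)" and "i < n" "j < n" "i \<noteq> j" "c < n" "d < n"
  shows "(skew_unit n i j \<otimes>\<^bsub>so n\<^esub> (skew_unit n i j \<otimes>\<^bsub>so n\<^esub> A)) $$ (c, d) =
    - (of_bool ((c \<in> {i, j}) \<noteq> (d \<in> {i, j})) * A $$ (c, d))"
proof -
  interpret lie_algebra "so n" by (rule lie_algebra_so)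
  have c: "A \<in> carrier_mat n n" using A by (rule so_carrier_mat)
  have c': "skew_unit n i j \<otimes>\<^bsub>so n\<^esub> A \<in> carrier_mat n n"
    using bracket_closed[OF skew_unit_carrier A] by (rule so_carrier_mat)
  have skew: "A $$ (y, x) = - A $$ (x, y)" if "x < n" "y < n" for x y
    using so_skew[OF A that] .
  have diag: "A $$ (x, x) = 0" if "x < n" for x
    using skew[OF that that] by simp
  show ?thesis
    using assms skew[of i j]
    by (simp add: index_bracket_skew_unit[OF c] index_bracket_skew_unit[OF c'] diag)
qed


text \<open>For n = 4 a pair {i, j} and its complement give the same projection, so complementary
  positions cannot be separated; \<open>so 4\<close> is indeed not simple.\<close>

lemma lie_simple_so:
  assumes n: "n = 3 \<or> n \<ge> 5"
  shows "lie_simple (so n)"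
proof -
  interpret lie_algebra "so n" by (rule lie_algebra_so)
  let ?F = "skew_unit n"
  have F_self: "?F i i = \<zero>\<^bsub>so n\<^esub>" for i
    by (rule eq_matI) (auto simp: skew_unit_def so_def)
  have F_step: "?F a b \<otimes>\<^bsub>so n\<^esub> ?F b c = ?F a c" if "a < n" "b < n" "c < n" "a \<noteq> b" "b \<noteq> c" "a \<noteq> c" for a b c
    using that by (subst bracket_skew_unit_skew_unit) (auto simp: F_self skew_unit_def intro!: eq_matI)
  have all: "carrier (so n) \<subseteq> I"
    if I: "lie_ideal I (so n)" and F: "?F a b \<in> I" "a < n" "b < n" "a \<noteq> b" for I a b
  proof -
    note sub = lie_ideal_submodule[OF lie_algebra_so I]
    interpret I: submodule class_ring I "so n" by (rule sub)
    have swap: "?F j i \<in> I" if "?F i j \<in> I" for i j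
      using I.smult_closed[of "-1"] that by (simp add: skew_unit_flip[of n j i])
    have right: "?F i k \<in> I" if "?F i j \<in> I" "i < n" "j < n" "k < n" "i \<noteq> j" "i \<noteq> k" for i j k
    proof (cases "k = j")
      case False
      then have "?F i j \<otimes>\<^bsub>so n\<^esub> ?F j k \<in> I"
        using lie_ideal_bracket(2)[OF lie_algebra_so I skew_unit_carrier] that by blast
      then show ?thesis using F_step[of i j k] that False by simp
    qed (use that in simp)
    have "?F i j \<in> I" if "i < n" "j < n" for i j
    proof (cases "i = j")
      case True
      then show ?thesis by (simp add: F_self)
    next
      case False
      \<comment> \<open>For i \<noteq> a the route is: change b into i, flip the indices, then
        change a into j.\<close>
      show ?thesis
      proof (cases "i = a")
        case True
        then show ?thesis using right[of a b j] F False that by auto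
      next
        case neq: False
        have "?F i a \<in> I" using right[of a b i] F neq that swap by auto
        then show ?thesis using right[of i a j] F False neq that by auto
      qed
    qed
    then show ?thesis by (rule so_submodule_eqI[OF sub])
  qed
  have "I = {\<zero>\<^bsub>so n\<^esub>} \<or> I = carrier (so n)" if I: "lie_ideal I (so n)" for I
  proof (rule ccontr)
    assume neg: "\<not> ?thesis"
    note sub = lie_ideal_submodule[OF lie_algebra_so I]
    interpret I: submodule class_ring I "so n" by (rule sub)
    obtain A where A: "A \<in> I" "A \<noteq> \<zero>\<^bsub>so n\<^esub>"
      using neg I.zero_closed by blast
    have A_so: "A \<in> carrier (so n)" using A I.subset by blast
    obtain a b where ab: "a < n" "b < n" "A $$ (a, b) \<noteq> 0"
      using A(2) so_carrier_mat[OF A_so] by (auto simp: so_def mat_eq_iff)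
    have "a \<noteq> b" using so_skew[OF A_so ab(1) ab(1)] ab by auto
    \<comment> \<open>The closed form of the operator - (ad \<open>?F i j\<close>)^2 for i \<noteq>
      j; the next fact says that \<open>I\<close> is stable under it.\<close>
    define P where "P i j B = mat n n (\<lambda>(c, d). of_bool ((c \<in> {i, j}) \<noteq> (d \<in> {i, j})) * B $$ (c, d))"
      for i j and B :: "complex mat"
    have P: "P i j B \<in> I" if B: "B \<in> I" and ij: "i < n" "j < n" "i \<noteq> j" for i j B
    proof -
      define C where "C = ?F i j \<otimes>\<^bsub>so n\<^esub> (?F i j \<otimes>\<^bsub>so n\<^esub> B)"
      have B': "B \<in> carrier (so n)" using B I.subset by blast
      have C: "C \<in> I" unfolding C_def using B lie_ideal_bracket(1)[OF lie_algebra_so I skew_unit_carrier] by blast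
      then have C': "C \<in> carrier_mat n n" using I.subset so_carrier_mat by blast
      have "C $$ (c, d) = - (of_bool ((c \<in> {i, j}) \<noteq> (d \<in> {i, j})) * B $$ (c, d))" if "c < n" "d < n" for c d
        unfolding C_def using index_bracket_bracket_skew_unit[OF B' ij that] .
      then have "P i j B = (-1) \<odot>\<^bsub>so n\<^esub> C"
        using C' by (intro eq_matI) (simp_all add: P_def so_def)
      then show ?thesis using C I.smult_closed[of "-1"] by simp
    qed
    have "A $$ (a, b) \<odot>\<^bsub>so n\<^esub> ?F a b \<in> I"
    proof (cases "n = 3")
      case True
      then have ab': "a < 3" "b < 3" using ab by simp_all
      have "\<exists>c<3. c \<noteq> a \<and> c \<noteq> b" by presburger
      then obtain c where c': "c < 3" "c \<noteq> a" "c \<noteq> b" by blast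
      then have c: "c < n" "c \<noteq> a" "c \<noteq> b" using True by simp_all
      have "{a, b, c} = {..<3}"
        using ab' c' \<open>a \<noteq> b\<close> by (intro card_subset_eq) auto
      then have cases: "x = a \<or> x = b \<or> x = c" if "x < n" for x
        using that True by blast
      \<comment> \<open>The inner projection removes the position {a, c}, the outer one {b, c}; only
        {a, b} is left.\<close>
      have "P b c (P a c A) = A $$ (a, b) \<odot>\<^bsub>so n\<^esub> ?F a b"
      proof (rule eq_matI)
        fix x y assume "x < dim_row (A $$ (a, b) \<odot>\<^bsub>so n\<^esub> ?F a b)" "y < dim_col (A $$ (a, b) \<odot>\<^bsub>so n\<^esub> ?F a b)"
        then have xy: "x < n" "y < n" by (simp_all add: so_def skew_unit_def)
        then show "P b c (P a c A) $$ (x, y) = (A $$ (a, b) \<odot>\<^bsub>so n\<^esub> ?F a b) $$ (x, y)"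
          using cases[OF xy(1)] cases[OF xy(2)] ab
          by (elim disjE) (simp_all add: P_def so_def skew_unit_def so_skew[OF A_so ab(1,2)]
            c c(2,3)[symmetric] \<open>a \<noteq> b\<close> \<open>a \<noteq> b\<close>[symmetric])
      qed (simp_all add: P_def so_def skew_unit_def)
      moreover have "P b c (P a c A) \<in> I"
        using A c ab by (intro P) auto
      ultimately show ?thesis by simp
    next
      case False
      then have "n \<ge> 5" using n by simp
      then have ex: "\<exists>c<n. c \<notin> set xs" if "length xs < 5" for xs
      proof -
        have "card (set xs) < card {..<n}" using that \<open>n \<ge> 5\<close> card_length[of xs] by simp
        then have "\<not> {..<n} \<subseteq> set xs" using card_mono[of "set xs" "{..<n}"] by auto
        then show ?thesis by auto
      qed
      obtain c where c: "c < n" "c \<noteq> a" "c \<noteq> b" using ex[of "[a, b]"] by auto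
      obtain d where d: "d < n" "d \<noteq> a" "d \<noteq> b" "d \<noteq> c" using ex[of "[a, b, c]"] by auto
      obtain e where e: "e < n" "e \<noteq> a" "e \<noteq> b" "e \<noteq> c" "e \<noteq> d" using ex[of "[a, b, c, d]"] by auto
      \<comment> \<open>A pair without a would have to contain c, d and e to survive the three inner
        projections. So only pairs {a, y} with y outside {c, d, e} are left, and the outer
        projection forces y = b.\<close>
      have "P b c (P a c (P a d (P a e A))) = A $$ (a, b) \<odot>\<^bsub>so n\<^esub> ?F a b"
      proof (rule eq_matI)
        fix x y assume "x < dim_row (A $$ (a, b) \<odot>\<^bsub>so n\<^esub> ?F a b)" "y < dim_col (A $$ (a, b) \<odot>\<^bsub>so n\<^esub> ?F a b)"
        then have xy: "x < n" "y < n" by (simp_all add: so_def skew_unit_def)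
        then show "P b c (P a c (P a d (P a e A))) $$ (x, y) = (A $$ (a, b) \<odot>\<^bsub>so n\<^esub> ?F a b) $$ (x, y)"
          using so_skew[OF A_so ab(1,2)] c d e \<open>a \<noteq> b\<close>
          by (cases "x = a"; cases "y = a"; cases "x = b"; cases "y = b") (auto simp: P_def so_def skew_unit_def)
      qed (simp_all add: P_def so_def skew_unit_def)
      moreover have "P b c (P a c (P a d (P a e A))) \<in> I"
        using A c d e ab by (intro P) auto
      ultimately show ?thesis by simp
    qed
    then have "(1 / A $$ (a, b)) \<odot>\<^bsub>so n\<^esub> (A $$ (a, b) \<odot>\<^bsub>so n\<^esub> ?F a b) \<in> I"
      using I.smult_closed by simp
    then have "?F a b \<in> I"
      using ab by (simp add: scale_scale skew_unit_carrier)
    then show False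
      using all[OF I _ ab(1,2) \<open>a \<noteq> b\<close>] neg I.subset by blast
  qed
  moreover have "?F 0 1 \<otimes>\<^bsub>so n\<^esub> ?F 1 2 \<noteq> \<zero>\<^bsub>so n\<^esub>"
  proof -
    have "?F 0 2 $$ (0, 2) \<noteq> 0\<^sub>m n n $$ (0, 2)" using n by (auto simp: skew_unit_def)
    then have "?F 0 2 \<noteq> \<zero>\<^bsub>so n\<^esub>" by (auto simp: so_def)
    then show ?thesis using F_step[of 0 1 2] n by auto
  qed
  ultimately show ?thesis
    unfolding lie_simple_def by (meson lie_algebra_so skew_unit_carrier)
qed

section \<open>Presented Lie algebras\<close>

lemma equiv_lie_cong: "equiv UNIV (lie_cong R)"
  by (rule equivI) (auto intro!: refl_onI symI transI intro: lie_cong.refl lie_cong.sym lie_cong.trans)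

lemma lie_class_eq_iff: "lie_class R s = lie_class R t \<longleftrightarrow> (s, t) \<in> lie_cong R"
  using eq_equiv_class_iff[OF equiv_lie_cong, of s t] by (simp add: lie_class_def)

lemma mem_lie_class: "t \<in> lie_class R t"
  by (simp add: lie_class_def lie_cong.refl)

lemma mem_lie_class_iff: "s \<in> lie_class R t \<longleftrightarrow> (t, s) \<in> lie_cong R"
  by (simp add: lie_class_def)

lemma carrier_lie_presented: "carrier (lie_presented R) = range (lie_class R)"
  by (auto simp: lie_presented_def lie_class_def quotient_def)

lemma zero_lie_presented: "\<zero>\<^bsub>lie_presented R\<^esub> = lie_class R Zero"
  by (simp add: lie_presented_def)

text \<open>The operations on classes are unions over representatives. They collapse to a single
  class because \<open>lie_cong\<close> is a congruence; the same argument serves for brackets and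
  scaling.\<close>

lemma add_lie_presented:
  "lie_class R s \<oplus>\<^bsub>lie_presented R\<^esub> lie_class R t = lie_class R (Add s t)"
proof -
  have *: "lie_class R (Add s' t') = lie_class R (Add s t)"
    if "s' \<in> lie_class R s" "t' \<in> lie_class R t" for s' t'
    using that by (simp add: mem_lie_class_iff lie_class_eq_iff lie_cong.Add lie_cong.sym)
  have "(\<Union>s'\<in>lie_class R s. \<Union>t'\<in>lie_class R t. lie_class R (Add s' t')) = lie_class R (Add s t)"
    by (rule UN_constant_eq[OF mem_lie_class], rule ballI, rule UN_constant_eq[OF mem_lie_class])
      (intro ballI *)
  then show ?thesis by (simp only: lie_presented_def ring.simps)
qed

lemma mult_lie_presented:
  "lie_class R s \<otimes>\<^bsub>lie_presented R\<^esub> lie_class R t = lie_class R (Bracket s t)"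
proof -
  have *: "lie_class R (Bracket s' t') = lie_class R (Bracket s t)"
    if "s' \<in> lie_class R s" "t' \<in> lie_class R t" for s' t'
    using that by (simp add: mem_lie_class_iff lie_class_eq_iff lie_cong.Bracket lie_cong.sym)
  have "(\<Union>s'\<in>lie_class R s. \<Union>t'\<in>lie_class R t. lie_class R (Bracket s' t')) = lie_class R (Bracket s t)"
    by (rule UN_constant_eq[OF mem_lie_class], rule ballI, rule UN_constant_eq[OF mem_lie_class])
      (intro ballI *)
  then show ?thesis by (simp only: lie_presented_def monoid.simps)
qed

lemma smult_lie_presented:
  "c \<odot>\<^bsub>lie_presented R\<^esub> lie_class R t = lie_class R (Scale c t)"
proof -
  have *: "lie_class R (Scale c t') = lie_class R (Scale c t)" if "t' \<in> lie_class R t" for t'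
    using that by (simp add: mem_lie_class_iff lie_class_eq_iff lie_cong.Scale lie_cong.sym)
  have "(\<Union>t'\<in>lie_class R t. lie_class R (Scale c t')) = lie_class R (Scale c t)"
    by (rule UN_constant_eq[OF mem_lie_class]) (intro ballI *)
  then show ?thesis by (simp only: lie_presented_def module.simps)
qed

lemmas lie_presented_ops =
  zero_lie_presented add_lie_presented mult_lie_presented smult_lie_presented

lemma lie_algebra_presented: "lie_algebra (lie_presented R)"
  by (rule lie_algebraI)
    (clarsimp simp: carrier_lie_presented lie_presented_ops lie_class_eq_iff;
      auto intro: lie_cong.add_assoc lie_cong.add_commute lie_cong.add_zero lie_cong.add_inverse
        lie_cong.scale_add_right lie_cong.scale_add_left lie_cong.scale_scale lie_cong.scale_one
        lie_cong.bracket_add_left lie_cong.bracket_add_right lie_cong.bracket_scale_left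
        lie_cong.bracket_scale_right lie_cong.bracket_alternating lie_cong.jacobi)+

section \<open>Homomorphisms out of a presented algebra\<close>

primrec lie_eval :: "'a lie \<Rightarrow> ('g \<Rightarrow> 'a) \<Rightarrow> 'g lie_term \<Rightarrow> 'a" where
  "lie_eval L \<phi> (Gen g) = \<phi> g"
| "lie_eval L \<phi> Zero = \<zero>\<^bsub>L\<^esub>"
| "lie_eval L \<phi> (Add s t) = lie_eval L \<phi> s \<oplus>\<^bsub>L\<^esub> lie_eval L \<phi> t"
| "lie_eval L \<phi> (Scale c s) = c \<odot>\<^bsub>L\<^esub> lie_eval L \<phi> s"
| "lie_eval L \<phi> (Bracket s t) = lie_eval L \<phi> s \<otimes>\<^bsub>L\<^esub> lie_eval L \<phi> t"

context lie_algebra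
begin

lemma lie_eval_closed:
  assumes "\<And>g. \<phi> g \<in> carrier L"
  shows "lie_eval L \<phi> t \<in> carrier L"
  by (induction t) (simp_all add: assms bracket_closed)

text \<open>Soundness of the equational calculus: every constructor of \<open>lie_cong\<close> other
  than \<open>relation\<close> holds in all Lie algebras, so only the relations need an
  assumption.\<close>

lemma lie_eval_cong:
  assumes \<phi>: "\<And>g. \<phi> g \<in> carrier L"
    and R: "\<And>s t. (s, t) \<in> R \<Longrightarrow> lie_eval L \<phi> s = lie_eval L \<phi> t"
    and st: "(s, t) \<in> lie_cong R"
  shows "lie_eval L \<phi> s = lie_eval L \<phi> t"
proof -
  note [simp] = lie_eval_closed[of \<phi>, OF \<phi>] bracket_closed
  have "lie_eval L \<phi> (fst p) = lie_eval L \<phi> (snd p)" if "p \<in> lie_cong R" for p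
    using that
  proof (induction p rule: lie_cong.induct)
    case (relation p)
    then show ?case using R by (cases p) simp
  qed (simp_all add: a_ac scale_minus_one l_neg r_neg scale_add_left scale_add_right scale_scale
      bracket_add_left bracket_add_right bracket_smult_left bracket_smult_right bracket_alternating jacobi)
  from this[OF st] show ?thesis by simp
qed

text \<open>The homomorphism evaluates any term that represents the class; soundness makes the
  choice irrelevant.\<close>

lemma lie_presented_universal:
  assumes \<phi>: "\<And>g. \<phi> g \<in> carrier L"
    and R: "\<And>s t. (s, t) \<in> R \<Longrightarrow> lie_eval L \<phi> s = lie_eval L \<phi> t"
  obtains f where "f \<in> LinearCombinations.module_hom class_ring (lie_presented R) L"
    and "\<And>x y. x \<in> carrier (lie_presented R) \<Longrightarrow> y \<in> carrier (lie_presented R) \<Longrightarrow>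
      f (x \<otimes>\<^bsub>lie_presented R\<^esub> y) = f x \<otimes> f y"
    and "\<And>g. f (lie_class R (Gen g)) = \<phi> g"
proof -
  define f where "f A = lie_eval L \<phi> (SOME t. A = lie_class R t)" for A
  have f: "f (lie_class R t) = lie_eval L \<phi> t" for t
  proof -
    have "lie_class R t = lie_class R (SOME s. lie_class R t = lie_class R s)"
      by (rule someI) (rule HOL.refl)
    then show ?thesis
      unfolding f_def lie_class_eq_iff by (metis lie_eval_cong[OF \<phi> R])
  qed
  show ?thesis
  proof (rule that[of f])
    show "f \<in> LinearCombinations.module_hom class_ring (lie_presented R) L"
      by (auto simp: LinearCombinations.module_hom_def carrier_lie_presented lie_presented_ops f
          lie_eval_closed[OF \<phi>])
  qed (auto simp: carrier_lie_presented lie_presented_ops f)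
qed

end

text \<open>If brackets of two generators stay in the span of the generators, this span is closed
  under all brackets and hence is everything. Membership in the span is phrased as membership in
  every subspace containing the generators, which is what a relation yields directly.\<close>

lemma lie_presented_spanned:
  assumes N: "LinearCombinations.submodule class_ring N (lie_presented R)"
    and gen: "\<And>g. lie_class R (Gen g) \<in> N"
    and bracket: "\<And>g h V. LinearCombinations.submodule class_ring V (lie_presented R) \<Longrightarrow>
      (\<And>g. lie_class R (Gen g) \<in> V) \<Longrightarrow> lie_class R (Bracket (Gen g) (Gen h)) \<in> V"
  shows "N = carrier (lie_presented R)"
proof -
  let ?P = "lie_presented R"
  interpret P: lie_algebra ?P by (rule lie_algebra_presented)
  let ?G = "range (\<lambda>g. lie_class R (Gen g))"
  define V where "V = P.span ?G"
  have G: "?G \<subseteq> carrier ?P" by (auto simp: carrier_lie_presented)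
  have V: "LinearCombinations.submodule class_ring V ?P"
    unfolding V_def by (rule P.span_is_submodule[OF G])
  have V_gen: "lie_class R (Gen g) \<in> V" for g
    unfolding V_def using P.in_own_span[OF G] by auto
  have V_min: "V \<subseteq> W" if "LinearCombinations.submodule class_ring W ?P" "\<And>g. lie_class R (Gen g) \<in> W" for W
    unfolding V_def using that by (intro P.span_is_subset) auto
  interpret V: LinearCombinations.submodule class_ring V ?P by (rule V)
  have V_car: "x \<in> carrier ?P" if "x \<in> V" for x using V.subset that by blast
  \<comment> \<open>The admissible \<open>y\<close> form a subspace containing the generators, hence
    all of \<open>V\<close>. Fact \<open>2\<close> repeats the argument in the first argument of the
    bracket.\<close>
  have 1: "lie_class R (Gen g) \<otimes>\<^bsub>?P\<^esub> y \<in> V" if "y \<in> V" for g y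
  proof -
    have g: "lie_class R (Gen g) \<in> carrier ?P" using G by auto
    let ?W = "{y \<in> carrier ?P. lie_class R (Gen g) \<otimes>\<^bsub>?P\<^esub> y \<in> V}"
    have "LinearCombinations.submodule class_ring ?W ?P"
      using g V.smult_closed
      by (intro LinearCombinations.submodule.intro P.module_axioms)
        (auto simp: P.bracket_add_right P.bracket_smult_right)
    moreover have "lie_class R (Gen h) \<in> ?W" for h
      using bracket[OF V V_gen] G by (auto simp: mult_lie_presented)
    ultimately show ?thesis using V_min[of ?W] that by blast
  qed
  have 2: "x \<otimes>\<^bsub>?P\<^esub> y \<in> V" if "x \<in> V" "y \<in> V" for x y
  proof -
    let ?W = "{x \<in> carrier ?P. x \<otimes>\<^bsub>?P\<^esub> y \<in> V}"
    have "LinearCombinations.submodule class_ring ?W ?P"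
      using V_car[OF that(2)] V.smult_closed
      by (intro LinearCombinations.submodule.intro P.module_axioms)
        (auto simp: P.bracket_add_left P.bracket_smult_left)
    moreover have "lie_class R (Gen h) \<in> ?W" for h
      using 1[OF that(2)] G by auto
    ultimately show ?thesis using V_min[of ?W] that by blast
  qed
  have "lie_class R t \<in> V" for t
  proof (induction t)
    case (Gen g)
    show ?case by (rule V_gen)
  next
    case Zero
    show ?case using V.zero_closed by (simp add: lie_presented_ops)
  next
    case (Add s t)
    then show ?case using V.m_closed[of "lie_class R s" "lie_class R t"] by (simp add: lie_presented_ops)
  next
    case (Scale c t)
    then show ?case using V.smult_closed[of c "lie_class R t"] by (simp add: lie_presented_ops)
  next
    case (Bracket s t)
    then show ?case using 2[of "lie_class R s" "lie_class R t"] by (simp add: lie_presented_ops)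
  qed
  then have "carrier ?P \<subseteq> V" by (auto simp: carrier_lie_presented)
  then show ?thesis
    using V_min[OF N gen] LinearCombinations.submodule.subset[OF N] by blast
qed

section \<open>The Lie algebra of an abelian group\<close>

lemma carrier_lie_copies: "carrier (lie_copies r L) = {..<r} \<rightarrow>\<^sub>E carrier L"
  by (simp add: lie_copies_def)

text \<open>\<open>c\<close> numbers the cosets of 2S and \<open>j\<close> the elements within each
  coset, so together they identify S with \<open>{..<r} \<times> {..<k}\<close>.\<close>

locale coset_coordinates =
  fixes c j :: "'s::{finite,ab_group_add} \<Rightarrow> nat" and k r :: nat
  assumes c_less: "c p < r" and j_less: "j p < k"
    and c_eq_iff: "c p = c q \<longleftrightarrow> (\<exists>\<alpha>. q = p + (\<alpha> + \<alpha>))"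
    and inj: "c p = c q \<Longrightarrow> j p = j q \<Longrightarrow> p = q"
    and surj: "i < r \<Longrightarrow> a < k \<Longrightarrow> \<exists>p. c p = i \<and> j p = a"
begin

abbreviation M :: "(nat \<Rightarrow> complex mat) lie" where "M \<equiv> lie_copies r (so k)"

sublocale M: lie_algebra M
  by (intro lie_algebra_copies lie_algebra_so)

sublocale so: lie_algebra "so k"
  by (rule lie_algebra_so)

sublocale gS: lie_algebra "gS :: ('s \<times> 's) lie_term set lie"
  unfolding gS_def by (rule lie_algebra_presented)

text \<open>Meant for p and q in the same coset, hence the component is read off from p
  alone.\<close>

definition coset_unit :: "'s \<Rightarrow> 's \<Rightarrow> nat \<Rightarrow> complex mat" where
  "coset_unit p q = (\<lambda>i\<in>{..<r}. if i = c p then skew_unit k (j p) (j q) else \<zero>\<^bsub>so k\<^esub>)"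

lemma coset_unit_closed [simp]: "coset_unit p q \<in> carrier M"
  by (auto simp: coset_unit_def carrier_lie_copies skew_unit_carrier)

lemma coset_unit_flip: "c p = c q \<Longrightarrow> coset_unit q p = (-1) \<odot>\<^bsub>M\<^esub> coset_unit p q"
  by (auto simp: coset_unit_def lie_copies_def skew_unit_flip[of k "j q" "j p"] intro!: restrict_ext)

text \<open>The structure constants of \<open>so k\<close>, arranged to match the four terms of the
  defining relation of \<open>gS\<close>: two of the units are flipped so that the signs become +,
  -, -, +.\<close>

lemma bracket_coset_unit:
  assumes pq: "c p = c q" and uv: "c u = c v"
  shows "coset_unit p q \<otimes>\<^bsub>M\<^esub> coset_unit u v = (of_bool (q = u) \<odot>\<^bsub>M\<^esub> coset_unit p v) \<oplus>\<^bsub>M\<^esub>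
    ((- of_bool (p = v) \<odot>\<^bsub>M\<^esub> coset_unit u q) \<oplus>\<^bsub>M\<^esub>
    ((- of_bool (q = v) \<odot>\<^bsub>M\<^esub> coset_unit p u) \<oplus>\<^bsub>M\<^esub> (of_bool (p = u) \<odot>\<^bsub>M\<^esub> coset_unit v q)))"
proof -
  have "coset_unit p q i \<otimes>\<^bsub>so k\<^esub> coset_unit u v i = (of_bool (q = u) \<odot>\<^bsub>so k\<^esub> coset_unit p v i) \<oplus>\<^bsub>so k\<^esub>
    ((- of_bool (p = v) \<odot>\<^bsub>so k\<^esub> coset_unit u q i) \<oplus>\<^bsub>so k\<^esub>
    ((- of_bool (q = v) \<odot>\<^bsub>so k\<^esub> coset_unit p u i) \<oplus>\<^bsub>so k\<^esub> (of_bool (p = u) \<odot>\<^bsub>so k\<^esub> coset_unit v q i)))" (is "_ = ?r")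
    if i: "i < r" for i
  proof (cases "i = c p \<and> i = c u")
    case True
    \<comment> \<open>Within one coset \<open>j\<close> is injective, so equality in S becomes
      equality of matrix indices.\<close>
    have eqs: "q = u \<longleftrightarrow> j q = j u" "p = v \<longleftrightarrow> j p = j v" "q = v \<longleftrightarrow> j q = j v" "p = u \<longleftrightarrow> j p = j u"
      using inj pq uv True by metis+
    have coset_unit: "coset_unit p q i = skew_unit k (j p) (j q)" "coset_unit u v i = skew_unit k (j u) (j v)"
      "coset_unit p v i = skew_unit k (j p) (j v)" "coset_unit u q i = skew_unit k (j u) (j q)"
      "coset_unit p u i = skew_unit k (j p) (j u)" "coset_unit v q i = skew_unit k (j v) (j q)"
      using True pq uv i by (simp_all add: coset_unit_def)
    define E :: "nat \<Rightarrow> nat \<Rightarrow> complex" where "E x y = of_bool (x = y)" for x y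
    have E: "of_bool (x = y) = E x y" for x y by (simp add: E_def)
    show ?thesis
      unfolding coset_unit eqs bracket_skew_unit_skew_unit[OF j_less j_less j_less j_less]
      by (rule eq_matI)
        (simp_all add: so_def E index_skew_unit, simp_all add: skew_unit_def algebra_simps)
  next
    case False
    have zero: "coset_unit x y i = \<zero>\<^bsub>so k\<^esub>" if "c x \<noteq> i" for x y
      using that i by (simp add: coset_unit_def)
    have car: "coset_unit x y i \<in> carrier (so k)" for x y
      using i by (simp add: coset_unit_def skew_unit_carrier)
    have "coset_unit p q i \<otimes>\<^bsub>so k\<^esub> coset_unit u v i = \<zero>\<^bsub>so k\<^esub>"
      using False zero[of p q] zero[of u v] car by (cases "i = c p") auto
    \<comment> \<open>If an indicator is 1, all of p, q, u, v lie in one coset, whose number is not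
      i, and the unit vanishes there; otherwise the scalar is 0.\<close>
    moreover have "?r = \<zero>\<^bsub>so k\<^esub>"
    proof -
      have "of_bool (q = u) \<odot>\<^bsub>so k\<^esub> coset_unit p v i = \<zero>\<^bsub>so k\<^esub>"
        using False pq uv zero[of p v] car by (cases "q = u") auto
      moreover have "- of_bool (p = v) \<odot>\<^bsub>so k\<^esub> coset_unit u q i = \<zero>\<^bsub>so k\<^esub>"
        using False pq uv zero[of u q] car by (cases "p = v") auto
      moreover have "- of_bool (q = v) \<odot>\<^bsub>so k\<^esub> coset_unit p u i = \<zero>\<^bsub>so k\<^esub>"
        using False pq uv zero[of p u] car by (cases "q = v") auto
      moreover have "of_bool (p = u) \<odot>\<^bsub>so k\<^esub> coset_unit v q i = \<zero>\<^bsub>so k\<^esub>"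
        using False pq uv zero[of v q] car by (cases "p = u") auto
      ultimately show ?thesis by simp
    qed
    ultimately show ?thesis by simp
  qed
  then show ?thesis
    by (auto simp: lie_copies_def intro!: restrict_ext)
qed

text \<open>The matrix unit attached to \<open>d\<^sup>\<alpha>\<^sup>,\<^sup>\<beta>\<close> has indices \<open>\<beta> - \<alpha>\<close> and \<open>\<alpha> + \<beta>\<close>, which differ by \<open>2\<alpha>\<close>
  and determine \<open>(\<alpha>, \<beta>)\<close> up to a common shift by \<open>S\<^sup>0\<close>.\<close>

definition \<phi> :: "'s \<times> 's \<Rightarrow> nat \<Rightarrow> complex mat" where
  "\<phi> = (\<lambda>(\<alpha>, \<beta>). coset_unit (\<beta> - \<alpha>) (\<alpha> + \<beta>))"

lemma c_sum_diff: "c (\<beta> - \<alpha>) = c (\<alpha> + \<beta>)"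
proof -
  have "\<alpha> + \<beta> = (\<beta> - \<alpha>) + (\<alpha> + \<alpha>)" by (simp add: algebra_simps)
  then show ?thesis using c_eq_iff by blast
qed

text \<open>With p = \<beta> - \<alpha>, q = \<alpha> + \<beta>, u = \<nu> - \<mu>, v = \<mu> +
  \<nu>, the four Kronecker conditions read q = u, p = v, q = v, p = u, as in
  \<open>bracket_coset_unit\<close>. Replacing \<alpha> by -\<alpha> swaps p and q, which gives the
  sign relation.\<close>

lemma lie_eval_gS_relations:
  assumes "(s, t) \<in> gS_relations"
  shows "lie_eval M \<phi> s = lie_eval M \<phi> t"
  using assms unfolding gS_relations_def
proof (elim UnE CollectE exE conjE, goal_cases)
  case (1 \<alpha> \<beta>)
  then show ?case
    using coset_unit_flip[OF c_sum_diff[of \<beta> \<alpha>]] by (simp add: \<phi>_def add.commute)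
next
  case (2 \<alpha> \<beta> \<mu> \<nu>)
  have conds: "(\<alpha> + \<mu> = \<nu> - \<beta>) = (\<alpha> + \<beta> = \<nu> - \<mu>)" "(\<alpha> + \<mu> = \<beta> - \<nu>) = (\<beta> - \<alpha> = \<mu> + \<nu>)"
    "(\<alpha> - \<mu> = \<nu> - \<beta>) = (\<alpha> + \<beta> = \<mu> + \<nu>)" "(\<alpha> - \<mu> = \<beta> - \<nu>) = (\<beta> - \<alpha> = \<nu> - \<mu>)"
    by (auto simp: algebra_simps)
  \<comment> \<open>The generators on the right have the required image only under their Kronecker
    condition; \<open>of_bool_cong\<close> allows that condition to be assumed, as the coefficient
    is 0 otherwise.\<close>
  have t1: "\<phi> (\<alpha> + \<mu>, - \<alpha> + \<nu>) = coset_unit (\<beta> - \<alpha>) (\<mu> + \<nu>)" if "\<alpha> + \<beta> = \<nu> - \<mu>"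
  proof -
    have "\<nu> = \<alpha> + \<beta> + \<mu>" using that by (simp add: algebra_simps)
    then show ?thesis by (simp add: \<phi>_def algebra_simps)
  qed
  have t2: "\<phi> (\<alpha> + \<mu>, \<alpha> + \<nu>) = coset_unit (\<nu> - \<mu>) (\<alpha> + \<beta>)" if "\<beta> - \<alpha> = \<mu> + \<nu>"
    using that by (simp add: \<phi>_def algebra_simps)
  have t3: "\<phi> (\<alpha> - \<mu>, \<nu> - \<alpha>) = coset_unit (\<beta> - \<alpha>) (\<nu> - \<mu>)" if "\<alpha> + \<beta> = \<mu> + \<nu>"
  proof -
    have \<beta>: "\<beta> = \<mu> + \<nu> - \<alpha>" using that by (simp add: algebra_simps)
    show ?thesis by (simp add: \<phi>_def \<beta> algebra_simps)
  qed
  have t4: "\<phi> (\<alpha> - \<mu>, \<alpha> + \<nu>) = coset_unit (\<mu> + \<nu>) (\<alpha> + \<beta>)" if "\<beta> - \<alpha> = \<nu> - \<mu>"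
  proof -
    have \<beta>: "\<beta> = \<nu> - \<mu> + \<alpha>" using that by (simp add: algebra_simps)
    show ?thesis by (simp add: \<phi>_def \<beta> algebra_simps)
  qed
  have of_bool_cong: "of_bool P \<odot>\<^bsub>M\<^esub> x = of_bool P \<odot>\<^bsub>M\<^esub> y" "- of_bool P \<odot>\<^bsub>M\<^esub> x = - of_bool P \<odot>\<^bsub>M\<^esub> y"
    if "P \<Longrightarrow> x = y" "x \<in> carrier M" "y \<in> carrier M" for P x y
    using that by (cases P; simp)+
  have \<phi>: "\<phi> x \<in> carrier M" for x by (simp add: \<phi>_def case_prod_beta)
  have "lie_eval M \<phi> s = coset_unit (\<beta> - \<alpha>) (\<alpha> + \<beta>) \<otimes>\<^bsub>M\<^esub> coset_unit (\<nu> - \<mu>) (\<mu> + \<nu>)"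
    using 2 by (simp add: \<phi>_def)
  also have "\<dots> = lie_eval M \<phi> t"
    unfolding bracket_coset_unit[OF c_sum_diff c_sum_diff]
    using 2 of_bool_cong(1)[OF t1 \<phi> coset_unit_closed] of_bool_cong(2)[OF t2 \<phi> coset_unit_closed]
      of_bool_cong(2)[OF t3 \<phi> coset_unit_closed] of_bool_cong(1)[OF t4 \<phi> coset_unit_closed]
    by (simp add: conds)
  finally show ?case .
qed

section \<open>The homomorphism onto r copies of the orthogonal algebra\<close>

lemma gS_hom_exists:
  "\<exists>proj. proj \<in> LinearCombinations.module_hom class_ring gS M \<and>
    (\<forall>x\<in>carrier gS. \<forall>y\<in>carrier gS. proj (x \<otimes>\<^bsub>gS\<^esub> y) = proj x \<otimes>\<^bsub>M\<^esub> proj y) \<and>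
    (\<forall>\<alpha> \<beta>. proj (gS_gen \<alpha> \<beta>) = coset_unit (\<beta> - \<alpha>) (\<alpha> + \<beta>))"
proof -
  have \<phi>: "\<phi> x \<in> carrier M" for x by (simp add: \<phi>_def case_prod_beta)
  show ?thesis
    by (rule M.lie_presented_universal[OF \<phi> lie_eval_gS_relations])
      (auto simp: gS_def gS_gen_def \<phi>_def)
qed

definition proj :: "('s \<times> 's) lie_term set \<Rightarrow> nat \<Rightarrow> complex mat" where
  "proj = (SOME proj. proj \<in> LinearCombinations.module_hom class_ring gS M \<and>
    (\<forall>x\<in>carrier gS. \<forall>y\<in>carrier gS. proj (x \<otimes>\<^bsub>gS\<^esub> y) = proj x \<otimes>\<^bsub>M\<^esub> proj y) \<and>
    (\<forall>\<alpha> \<beta>. proj (gS_gen \<alpha> \<beta>) = coset_unit (\<beta> - \<alpha>) (\<alpha> + \<beta>)))"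

lemma proj_hom: "proj \<in> LinearCombinations.module_hom class_ring gS M"
  and proj_bracket: "x \<in> carrier gS \<Longrightarrow> y \<in> carrier gS \<Longrightarrow> proj (x \<otimes>\<^bsub>gS\<^esub> y) = proj x \<otimes>\<^bsub>M\<^esub> proj y"
  and proj_gen: "proj (gS_gen \<alpha> \<beta>) = coset_unit (\<beta> - \<alpha>) (\<alpha> + \<beta>)"
  using someI_ex[OF gS_hom_exists] unfolding proj_def[symmetric] by blast+

sublocale proj: mod_hom class_ring gS M proj
  by unfold_locales (rule proj_hom)

lemma gS_gen_closed [simp]: "gS_gen \<alpha> \<beta> \<in> carrier gS"
  by (simp add: gS_gen_def gS_def carrier_lie_presented)

text \<open>The image is a subspace. It contains the units of each component, hence every matrix
  placed in one component, hence all sums of these.\<close>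

lemma proj_surj: "proj ` carrier gS = carrier M"
proof
  show "proj ` carrier gS \<subseteq> carrier M" by auto
  define W where "W = proj ` carrier gS"
  interpret W: LinearCombinations.submodule class_ring W M
    using proj.im_is_submodule by (simp add: W_def proj.im_def)
  have coset_unit: "coset_unit p q \<in> W" if "c p = c q" for p q
  proof -
    obtain \<alpha> where "q = p + (\<alpha> + \<alpha>)" using \<open>c p = c q\<close> c_eq_iff by blast
    \<comment> \<open>With \<beta> = p + \<alpha> one gets \<beta> - \<alpha> = p and \<alpha> +
      \<beta> = p + 2\<alpha> = q.\<close>
    then have "coset_unit p q = proj (gS_gen \<alpha> (p + \<alpha>))" by (simp add: proj_gen algebra_simps)
    then show ?thesis by (simp add: W_def)
  qed
  define one where "one i A = (\<lambda>l\<in>{..<r}. if l = i then A else \<zero>\<^bsub>so k\<^esub>)" for i and A :: "complex mat"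
  have one: "one i A \<in> W" if i: "i < r" and A: "A \<in> carrier (so k)" for i A
  proof -
    let ?N = "{A \<in> carrier (so k). one i A \<in> W}"
    have add: "one i (A \<oplus>\<^bsub>so k\<^esub> B) = one i A \<oplus>\<^bsub>M\<^esub> one i B" for A B
      using so.zero_closed by (auto simp: one_def lie_copies_def intro!: restrict_ext)
    have smult: "one i (b \<odot>\<^bsub>so k\<^esub> A) = b \<odot>\<^bsub>M\<^esub> one i A" for A b
      by (auto simp: one_def lie_copies_def intro!: restrict_ext)
    have zero: "one i \<zero>\<^bsub>so k\<^esub> = \<zero>\<^bsub>M\<^esub>"
      by (auto simp: one_def lie_copies_def intro!: restrict_ext)
    have "LinearCombinations.submodule class_ring ?N (so k)"
      using W.smult_closed
      by (intro LinearCombinations.submodule.intro so.module_axioms)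
        (auto simp: add smult zero)
    moreover have "skew_unit k a b \<in> ?N" if ab: "a < k" "b < k" for a b
    proof -
      obtain p q where "c p = i" "j p = a" "c q = i" "j q = b" using surj i ab by metis
      then have "one i (skew_unit k a b) = coset_unit p q" "c p = c q" by (auto simp: one_def coset_unit_def)
      then show ?thesis using coset_unit skew_unit_carrier by auto
    qed
    ultimately have "carrier (so k) \<subseteq> ?N" by (rule so_submodule_eqI)
    then show ?thesis using A by blast
  qed
  show "carrier M \<subseteq> proj ` carrier gS"
  proof
    fix m assume m: "m \<in> carrier M"
    \<comment> \<open>\<open>m\<close> is built up one component at a time.\<close>
    have "n \<le> r \<Longrightarrow> (\<lambda>l\<in>{..<r}. if l < n then m l else \<zero>\<^bsub>so k\<^esub>) \<in> W" for n
    proof (induction n)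
      case 0
      then show ?case using W.zero_closed by (simp add: lie_copies_def restrict_def)
    next
      case (Suc n)
      have mn: "m l \<in> carrier (so k)" if "l < r" for l
        using m that by (auto simp: carrier_lie_copies PiE_iff)
      have eq: "(\<lambda>l\<in>{..<r}. if l < Suc n then m l else \<zero>\<^bsub>so k\<^esub>) =
        (\<lambda>l\<in>{..<r}. if l < n then m l else \<zero>\<^bsub>so k\<^esub>) \<oplus>\<^bsub>M\<^esub> one n (m n)"
        using mn by (auto simp: one_def lie_copies_def intro!: restrict_ext)
      show ?case
        unfolding eq by (intro W.m_closed Suc.IH one mn) (use Suc.prems in simp_all)
    qed
    from this[of r] have "(\<lambda>l\<in>{..<r}. if l < r then m l else \<zero>\<^bsub>so k\<^esub>) \<in> W" by simp
    moreover have "(\<lambda>l\<in>{..<r}. if l < r then m l else \<zero>\<^bsub>so k\<^esub>) = m"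
      using m by (auto simp: carrier_lie_copies PiE_iff extensional_def restrict_def fun_eq_iff)
    ultimately show "m \<in> proj ` carrier gS" by (simp add: W_def)
  qed
qed

section \<open>The ideal as the kernel\<close>

definition gens :: "('s \<times> 's) lie_term set set" where
  "gens = {gS_gen (\<alpha> + \<gamma>) (\<beta> + \<gamma>) \<ominus>\<^bsub>gS\<^esub> gS_gen \<alpha> \<beta> | \<alpha> \<beta> \<gamma>. \<gamma> + \<gamma> = 0}"

lemma gens_carrier: "gens \<subseteq> carrier gS"
  by (auto simp: gens_def)

lemma gS_ideal_span: "gS_ideal = gS.span gens"
  by (simp add: gS_ideal_def gens_def)

sublocale I: LinearCombinations.submodule class_ring gS_ideal "gS :: ('s \<times> 's) lie_term set lie"
  unfolding gS_ideal_span by (rule gS.span_is_submodule[OF gens_carrier])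

lemma shift_mem_ideal:
  assumes "\<gamma> + \<gamma> = (0 :: 's)"
  shows "gS_gen (\<alpha> + \<gamma>) (\<beta> + \<gamma>) \<ominus>\<^bsub>gS\<^esub> gS_gen \<alpha> \<beta> \<in> gS_ideal"
proof -
  have "gens \<subseteq> gS_ideal"
    unfolding gS_ideal_span by (rule gS.in_own_span[OF gens_carrier])
  then show ?thesis using assms by (auto simp: gens_def)
qed

text \<open>A common shift by \<gamma> leaves \<beta> - \<alpha> unchanged and changes \<alpha> +
  \<beta> by 2\<gamma> = 0.\<close>

lemma ideal_subset_kernel: "gS_ideal \<subseteq> {x \<in> carrier gS. proj x = \<zero>\<^bsub>M\<^esub>}"
  unfolding gS_ideal_span
proof (rule gS.span_is_subset)
  show "LinearCombinations.submodule class_ring {x \<in> carrier gS. proj x = \<zero>\<^bsub>M\<^esub>} (gS :: ('s \<times> 's) lie_term set lie)"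
    using proj.ker_is_submodule by (simp add: proj.ker_def)
  show "gens \<subseteq> {x \<in> carrier gS. proj x = \<zero>\<^bsub>M\<^esub>}"
  proof
    fix x assume "x \<in> gens"
    then obtain \<alpha> \<beta> \<gamma> where x: "x = gS_gen (\<alpha> + \<gamma>) (\<beta> + \<gamma>) \<ominus>\<^bsub>gS\<^esub> gS_gen \<alpha> \<beta>" and "\<gamma> + \<gamma> = 0"
      by (auto simp: gens_def)
    have "\<alpha> + \<gamma> + (\<beta> + \<gamma>) = \<alpha> + \<beta> + (\<gamma> + \<gamma>)" by (simp only: ac_simps)
    also have "\<dots> = \<alpha> + \<beta>" using \<open>\<gamma> + \<gamma> = 0\<close> by simp
    finally have eq: "\<alpha> + \<gamma> + (\<beta> + \<gamma>) = \<alpha> + \<beta>" .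
    have "proj (gS_gen (\<alpha> + \<gamma>) (\<beta> + \<gamma>)) = proj (gS_gen \<alpha> \<beta>)"
      unfolding proj_gen eq by simp
    then show "x \<in> {x \<in> carrier gS. proj x = \<zero>\<^bsub>M\<^esub>}"
      by (simp add: x a_minus_def M.r_neg)
  qed
qed

lemma gS_gen_uminus: "gS_gen (- \<alpha>) \<beta> = (-1) \<odot>\<^bsub>gS\<^esub> gS_gen \<alpha> (\<beta> :: 's)"
  unfolding gS_gen_def gS_def smult_lie_presented lie_class_eq_iff
  by (rule lie_cong.relation) (auto simp: gS_relations_def)

text \<open>The defining relation writes the bracket of two generators as a linear combination of
  generators, so the generators span \<open>gS\<close>.\<close>

lemma gS_spanned:
  assumes N: "LinearCombinations.submodule class_ring N (gS :: ('s \<times> 's) lie_term set lie)"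
    and gen: "\<And>\<alpha> \<beta>. gS_gen \<alpha> \<beta> \<in> N"
  shows "N = carrier gS"
  using N unfolding gS_def
proof (rule lie_presented_spanned)
  show "lie_class gS_relations (Gen g) \<in> N" for g
    using gen[of "fst g" "snd g"] by (simp add: gS_gen_def)
next
  fix g h :: "'s \<times> 's" and V
  assume V: "LinearCombinations.submodule class_ring V (lie_presented (gS_relations :: (('s \<times> 's) lie_term \<times> _) set))"
    and gen: "\<And>g. lie_class gS_relations (Gen g) \<in> V"
  interpret V: LinearCombinations.submodule class_ring V "lie_presented gS_relations" by (rule V)
  have add: "lie_class gS_relations (Add s t) \<in> V"
    if "lie_class gS_relations s \<in> V" "lie_class gS_relations t \<in> V" for s t
    using V.m_closed[OF that] by (simp add: add_lie_presented)
  have scale: "lie_class gS_relations (Scale b s) \<in> V" if "lie_class gS_relations s \<in> V" for b s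
    using V.smult_closed[OF _ that, of b] by (simp add: smult_lie_presented)
  obtain \<alpha> \<beta> \<mu> \<nu> where gh: "g = (\<alpha>, \<beta>)" "h = (\<mu>, \<nu>)" by (cases g, cases h)
  let ?t = "Add (Scale (of_bool (\<alpha> + \<mu> = \<nu> - \<beta>)) (D (\<alpha> + \<mu>) (- \<alpha> + \<nu>)))
      (Add (Scale (- of_bool (\<alpha> + \<mu> = \<beta> - \<nu>)) (D (\<alpha> + \<mu>) (\<alpha> + \<nu>)))
      (Add (Scale (- of_bool (\<alpha> - \<mu> = \<nu> - \<beta>)) (D (\<alpha> - \<mu>) (\<nu> - \<alpha>)))
           (Scale (of_bool (\<alpha> - \<mu> = \<beta> - \<nu>)) (D (\<alpha> - \<mu>) (\<alpha> + \<nu>)))))"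
  have "(Bracket (Gen g) (Gen h), ?t) \<in> gS_relations"
    unfolding gS_relations_def gh by blast
  then have "lie_class gS_relations (Bracket (Gen g) (Gen h)) = lie_class gS_relations ?t"
    unfolding lie_class_eq_iff by (rule lie_cong.relation)
  also have "\<dots> \<in> V" by (intro add scale gen)
  finally show "lie_class gS_relations (Bracket (Gen g) (Gen h)) \<in> V" .
qed

text \<open>A linear section of \<open>proj\<close> modulo the ideal: the entry in position \<open>(p, q)\<close> is sent to the
  generator with \<open>\<beta> - \<alpha> = p\<close> and \<open>\<alpha> + \<beta> = q\<close> for some choice of \<open>\<alpha>\<close> with \<open>q - p = 2\<alpha>\<close>. Entries are
  halved because every pair is counted a second time as \<open>(q, p)\<close>.\<close>

definition rep :: "'s \<times> 's \<Rightarrow> ('s \<times> 's) lie_term set" where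
  "rep = (\<lambda>(p, q). let \<alpha> = (SOME \<alpha>. q = p + (\<alpha> + \<alpha>)) in gS_gen \<alpha> (p + \<alpha>))"

definition \<tau> :: "('s \<times> 's \<Rightarrow> complex) \<Rightarrow> ('s \<times> 's) lie_term set" where
  "\<tau> a = (\<Oplus>\<^bsub>gS\<^esub> x\<in>UNIV. a x \<odot>\<^bsub>gS\<^esub> rep x)"

definition half_entries :: "(nat \<Rightarrow> complex mat) \<Rightarrow> 's \<times> 's \<Rightarrow> complex" where
  "half_entries m = (\<lambda>(p, q). if c p = c q then m (c p) $$ (j p, j q) / 2 else 0)"

lemma rep_closed [simp]: "rep x \<in> carrier gS"
  by (simp add: rep_def Let_def case_prod_beta)

lemma \<tau>_closed [simp]: "\<tau> a \<in> carrier gS"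
  unfolding \<tau>_def by (rule gS.M.finsum_closed) simp

lemma \<tau>_add: "\<tau> (\<lambda>x. a x + b x) = \<tau> a \<oplus>\<^bsub>gS\<^esub> \<tau> b"
  unfolding \<tau>_def by (simp add: gS.scale_add_left gS.M.finsum_addf)

lemma \<tau>_scale: "\<tau> (\<lambda>x. b * a x) = b \<odot>\<^bsub>gS\<^esub> \<tau> a"
  unfolding \<tau>_def by (subst gS.finsum_smult_ldistr) (simp_all add: gS.scale_scale)

lemma \<tau>_single: "\<tau> (\<lambda>x. of_bool (y = x)) = rep y"
proof -
  have "\<tau> (\<lambda>x. of_bool (y = x)) = (\<Oplus>\<^bsub>gS\<^esub> x\<in>UNIV. if y = x then rep x else \<zero>\<^bsub>gS\<^esub>)"
    unfolding \<tau>_def by (rule gS.M.finsum_cong') auto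
  also have "\<dots> = rep y" by (rule gS.M.finsum_singleton) auto
  finally show ?thesis .
qed

text \<open>The chosen \<alpha>' satisfies 2\<alpha>' = 2\<alpha>, so the two generators differ by a
  common shift by \<alpha>' - \<alpha>, an element of \<open>S\<^sup>0\<close>.\<close>

lemma rep_congruent: "rep (\<beta> - \<alpha>, \<alpha> + \<beta>) \<ominus>\<^bsub>gS\<^esub> gS_gen \<alpha> \<beta> \<in> gS_ideal"
proof -
  define \<alpha>' where "\<alpha>' = (SOME \<alpha>'. \<alpha> + \<beta> = (\<beta> - \<alpha>) + (\<alpha>' + \<alpha>'))"
  have "\<alpha> + \<beta> = (\<beta> - \<alpha>) + (\<alpha>' + \<alpha>')"
    unfolding \<alpha>'_def by (rule someI[of _ \<alpha>]) (simp add: algebra_simps)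
  then have "(\<alpha>' - \<alpha>) + (\<alpha>' - \<alpha>) = 0" by (simp add: algebra_simps)
  note mem = shift_mem_ideal[OF this, of \<alpha> \<beta>]
  have "rep (\<beta> - \<alpha>, \<alpha> + \<beta>) = gS_gen \<alpha>' (\<beta> - \<alpha> + \<alpha>')"
    by (simp only: rep_def Let_def prod.case \<alpha>'_def)
  moreover have "\<alpha> + (\<alpha>' - \<alpha>) = \<alpha>'" "\<beta> + (\<alpha>' - \<alpha>) = \<beta> - \<alpha> + \<alpha>'"
    by (simp_all add: algebra_simps)
  ultimately show ?thesis using mem by (simp only:)
qed

lemma half_entries_add:
  assumes "m \<in> carrier M" "m' \<in> carrier M"
  shows "half_entries (m \<oplus>\<^bsub>M\<^esub> m') = (\<lambda>x. half_entries m x + half_entries m' x)"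
proof -
  have "m (c p) \<in> carrier_mat k k" "m' (c p) \<in> carrier_mat k k" for p
    using assms c_less[of p] by (auto simp: carrier_lie_copies PiE_iff intro: so_carrier_mat)
  note carrier_matD[OF this(1)] carrier_matD[OF this(2)]
  then show ?thesis
    using c_less j_less by (auto simp: half_entries_def lie_copies_def so_def fun_eq_iff add_divide_distrib)
qed

lemma half_entries_smult:
  assumes "m \<in> carrier M"
  shows "half_entries (b \<odot>\<^bsub>M\<^esub> m) = (\<lambda>x. b * half_entries m x)"
proof -
  have "m (c p) \<in> carrier_mat k k" for p
    using assms c_less[of p] by (auto simp: carrier_lie_copies PiE_iff intro: so_carrier_mat)
  note carrier_matD[OF this]
  then show ?thesis
    using c_less j_less by (auto simp: half_entries_def lie_copies_def so_def fun_eq_iff)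
qed

text \<open>Written as a combination of point indicators, to which \<open>\<tau>_add\<close>,
  \<open>\<tau>_scale\<close> and \<open>\<tau>_single\<close> apply; for p = q the two terms
  cancel.\<close>

lemma half_entries_coset_unit:
  assumes "c p = c q"
  shows "half_entries (coset_unit p q) = (\<lambda>x. 1/2 * of_bool ((p, q) = x) + (-1/2) * of_bool ((q, p) = x))"
proof
  fix x :: "'s \<times> 's"
  obtain u v where x: "x = (u, v)" by (cases x)
  have e: "p = u \<longleftrightarrow> c p = c u \<and> j p = j u" "q = v \<longleftrightarrow> c q = c v \<and> j q = j v"
     "q = u \<longleftrightarrow> c q = c u \<and> j q = j u" "p = v \<longleftrightarrow> c p = c v \<and> j p = j v"
    using inj by metis+
  have "half_entries (coset_unit p q) (u, v) = (if c u = c v then coset_unit p q (c u) $$ (j u, j v) / 2 else 0)"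
    by (simp add: half_entries_def)
  also have "\<dots> = 1/2 * of_bool (p = u \<and> q = v) + (-1/2) * of_bool (q = u \<and> p = v)"
  proof (cases "c u = c p \<and> c v = c p")
    case True
    then show ?thesis
      using c_less[of p] assms unfolding e
      by (cases "j u = j p"; cases "j v = j q"; cases "j u = j q"; cases "j v = j p")
        (simp_all add: coset_unit_def index_skew_unit j_less)
  next
    case False
    then have "\<not> (p = u \<and> q = v)" "\<not> (q = u \<and> p = v)"
      using assms by auto
    then have "of_bool (p = u \<and> q = v) = (0 :: complex)" "of_bool (q = u \<and> p = v) = (0 :: complex)"
      by (simp_all only: of_bool_eq)
    moreover have "coset_unit p q (c u) $$ (j u, j v) = 0" if "c u = c v"
    proof -
      have "c u \<noteq> c p" using False that by auto
      then have "coset_unit p q (c u) = 0\<^sub>m k k" using c_less[of u] by (simp add: coset_unit_def so_def)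
      then show ?thesis by (simp add: j_less)
    qed
    ultimately show ?thesis
      by (cases "c u = c v") (simp_all only: if_True if_False simp_thms div_0 mult_zero_right add_0_left)
  qed
  finally show "half_entries (coset_unit p q) x = 1/2 * of_bool ((p, q) = x) + (-1/2) * of_bool ((q, p) = x)"
    by (simp add: x)
qed

text \<open>Both sides are linear in x, so generators suffice. There the section gives half of
  \<open>rep (p, q)\<close> minus half of \<open>rep (q, p)\<close>, and modulo the ideal these
  representatives are the generator and its negative.\<close>

lemma section_congruent:
  assumes "x \<in> carrier gS"
  shows "\<tau> (half_entries (proj x)) \<ominus>\<^bsub>gS\<^esub> x \<in> gS_ideal"
proof -
  let ?s = "\<lambda>x. \<tau> (half_entries (proj x))"
  let ?Z = "{x \<in> carrier gS. ?s x \<ominus>\<^bsub>gS\<^esub> x \<in> gS_ideal}"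
  have minus: "y \<ominus>\<^bsub>gS\<^esub> x = y \<oplus>\<^bsub>gS\<^esub> (-1) \<odot>\<^bsub>gS\<^esub> x" if "x \<in> carrier gS" for x y :: "('s \<times> 's) lie_term set"
    using that by (simp add: a_minus_def gS.scale_minus_one)
  have fx: "proj x \<in> carrier M" if "x \<in> carrier gS" for x using that by simp
  have s_add: "?s (x \<oplus>\<^bsub>gS\<^esub> y) = ?s x \<oplus>\<^bsub>gS\<^esub> ?s y" if "x \<in> carrier gS" "y \<in> carrier gS" for x y
    using that by (simp add: half_entries_add[OF fx fx] \<tau>_add)
  have s_smult: "?s (b \<odot>\<^bsub>gS\<^esub> x) = b \<odot>\<^bsub>gS\<^esub> ?s x" if "x \<in> carrier gS" for b x
    using that by (simp add: half_entries_smult[OF fx] \<tau>_scale)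
  have "LinearCombinations.submodule class_ring ?Z gS"
  proof (rule LinearCombinations.submodule.intro[OF gS.module_axioms])
    show "?Z \<subseteq> carrier gS" by blast
    show "x \<oplus>\<^bsub>gS\<^esub> y \<in> ?Z" if "x \<in> ?Z" "y \<in> ?Z" for x y
    proof -
      have x: "x \<in> carrier gS" and y: "y \<in> carrier gS" using that by auto
      have "?s (x \<oplus>\<^bsub>gS\<^esub> y) \<ominus>\<^bsub>gS\<^esub> (x \<oplus>\<^bsub>gS\<^esub> y) = (?s x \<ominus>\<^bsub>gS\<^esub> x) \<oplus>\<^bsub>gS\<^esub> (?s y \<ominus>\<^bsub>gS\<^esub> y)"
        using x y unfolding s_add[OF x y] by (simp add: minus gS.scale_add_right gS.M.a_ac)
      then show ?thesis using that I.m_closed by simp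
    qed
    show "b \<odot>\<^bsub>gS\<^esub> x \<in> ?Z" if "x \<in> ?Z" for b x
    proof -
      have x: "x \<in> carrier gS" using that by auto
      have "?s (b \<odot>\<^bsub>gS\<^esub> x) \<ominus>\<^bsub>gS\<^esub> (b \<odot>\<^bsub>gS\<^esub> x) = b \<odot>\<^bsub>gS\<^esub> (?s x \<ominus>\<^bsub>gS\<^esub> x)"
        using x unfolding s_smult[OF x] by (simp add: minus gS.scale_add_right gS.scale_scale)
      then show ?thesis using that I.smult_closed[of b] by simp
    qed
    have "?s \<zero>\<^bsub>gS\<^esub> = \<zero>\<^bsub>gS\<^esub>" using s_smult[of "\<zero>\<^bsub>gS\<^esub>" 0] by simp
    then show "\<zero>\<^bsub>gS\<^esub> \<in> ?Z" using I.zero_closed by (simp add: minus)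
  qed
  moreover have "gS_gen \<alpha> \<beta> \<in> ?Z" for \<alpha> \<beta>
  proof -
    let ?g = "gS_gen \<alpha> \<beta>" and ?p = "\<beta> - \<alpha>" and ?q = "\<alpha> + \<beta>"
    let ?x = "rep (?p, ?q) \<ominus>\<^bsub>gS\<^esub> ?g" and ?y = "rep (?q, ?p) \<ominus>\<^bsub>gS\<^esub> gS_gen (- \<alpha>) \<beta>"
    have x: "?x \<in> gS_ideal" by (rule rep_congruent)
    \<comment> \<open>Swapping p and q amounts to replacing \<alpha> by -\<alpha>.\<close>
    have y: "?y \<in> gS_ideal" using rep_congruent[of \<beta> "- \<alpha>"] by (simp add: add.commute)
    have "?s ?g = (1/2) \<odot>\<^bsub>gS\<^esub> rep (?p, ?q) \<oplus>\<^bsub>gS\<^esub> (-1/2) \<odot>\<^bsub>gS\<^esub> rep (?q, ?p)"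
      unfolding proj_gen half_entries_coset_unit[OF c_sum_diff] \<tau>_add \<tau>_scale \<tau>_single ..
    then have "?s ?g \<ominus>\<^bsub>gS\<^esub> ?g =
      ((1/2) \<odot>\<^bsub>gS\<^esub> rep (?p, ?q) \<oplus>\<^bsub>gS\<^esub> (-1/2) \<odot>\<^bsub>gS\<^esub> rep (?q, ?p)) \<oplus>\<^bsub>gS\<^esub> (-1) \<odot>\<^bsub>gS\<^esub> ?g"
      by (simp only: minus[OF gS_gen_closed])
    \<comment> \<open>One half of the generator is paired with each of the two
      representatives.\<close>
    also have "(-1) \<odot>\<^bsub>gS\<^esub> ?g = (-1/2) \<odot>\<^bsub>gS\<^esub> ?g \<oplus>\<^bsub>gS\<^esub> (-1/2) \<odot>\<^bsub>gS\<^esub> ?g"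
      by (simp flip: gS.scale_add_left)
    also have "((1/2) \<odot>\<^bsub>gS\<^esub> rep (?p, ?q) \<oplus>\<^bsub>gS\<^esub> (-1/2) \<odot>\<^bsub>gS\<^esub> rep (?q, ?p)) \<oplus>\<^bsub>gS\<^esub> \<dots> =
      (1/2) \<odot>\<^bsub>gS\<^esub> ?x \<oplus>\<^bsub>gS\<^esub> (-1/2) \<odot>\<^bsub>gS\<^esub> ?y"
      by (simp add: minus gS_gen_uminus gS.scale_add_right gS.scale_scale gS.M.a_ac)
    also have "\<dots> \<in> gS_ideal"
      using x y I.smult_closed by (intro I.m_closed) auto
    finally show ?thesis by simp
  qed
  ultimately have "?Z = carrier gS" by (rule gS_spanned)
  then show ?thesis using assms by blast
qed

text \<open>On the kernel the section gives 0, so \<open>section_congruent\<close> puts the negative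
  of x into the ideal.\<close>

lemma gS_ideal_eq_kernel: "gS_ideal = {x \<in> carrier gS. proj x = \<zero>\<^bsub>M\<^esub>}"
proof (rule subset_antisym[OF ideal_subset_kernel])
  show "{x \<in> carrier gS. proj x = \<zero>\<^bsub>M\<^esub>} \<subseteq> gS_ideal"
  proof
    fix x assume "x \<in> {x \<in> carrier gS. proj x = \<zero>\<^bsub>M\<^esub>}"
    then have x: "x \<in> carrier gS" "proj x = \<zero>\<^bsub>M\<^esub>" by auto
    have "half_entries \<zero>\<^bsub>M\<^esub> = (\<lambda>x. 0 * half_entries \<zero>\<^bsub>M\<^esub> x)"
      using half_entries_smult[of "\<zero>\<^bsub>M\<^esub>" 0] by simp
    then have "\<tau> (half_entries (proj x)) = \<zero>\<^bsub>gS\<^esub>"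
      using \<tau>_scale[of 0 "half_entries \<zero>\<^bsub>M\<^esub>"] x by simp
    then have "\<ominus>\<^bsub>gS\<^esub> x \<in> gS_ideal"
      using section_congruent[OF x(1)] x by (simp add: a_minus_def)
    then have "(-1) \<odot>\<^bsub>gS\<^esub> (\<ominus>\<^bsub>gS\<^esub> x) \<in> gS_ideal"
      using I.smult_closed[of "-1"] by simp
    then show "x \<in> gS_ideal" using x by (simp add: gS.scale_minus_one)
  qed
qed

theorem lie_quot_gS_isomorphic:
  "lie_isomorphic (lie_quot (gS :: ('s \<times> 's) lie_term set lie) gS_ideal) (lie_copies r (so k))"
  using gS.lie_algebra_axioms M.lie_algebra_axioms proj_hom proj_bracket proj_surj gS_ideal_eq_kernel
  by (rule lie_first_isomorphism)

end

section \<open>Numbering the cosets of 2S\<close>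

lemma coset_coordinates_exist:
  fixes k r :: nat
  assumes k: "k = card (double_subgroup :: 's::{finite,ab_group_add} set)"
    and r: "r = card (double_cosets :: 's set set)"
  shows "\<exists>c j :: 's \<Rightarrow> nat. coset_coordinates c j k r"
proof -
  define C where "C p = (+) p ` (double_subgroup :: 's set)" for p :: 's
  have mem: "q \<in> C p \<longleftrightarrow> (\<exists>\<alpha>. q = p + (\<alpha> + \<alpha>))" for p q
    by (auto simp: C_def double_subgroup_def)
  have C_eq: "C p = C q \<longleftrightarrow> q \<in> C p" for p q
  proof
    assume "C p = C q"
    moreover have "q \<in> C q" using mem[of q q] by (metis add.right_neutral)
    ultimately show "q \<in> C p" by simp
  next
    assume "q \<in> C p"
    then obtain \<alpha> where \<alpha>: "q = p + (\<alpha> + \<alpha>)" using mem by blast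
    show "C p = C q"
    proof (intro subset_antisym subsetI)
      fix x assume "x \<in> C p"
      then obtain \<beta> where "x = p + (\<beta> + \<beta>)" using mem by blast
      then have "x = q + ((\<beta> - \<alpha>) + (\<beta> - \<alpha>))" by (simp add: \<alpha> algebra_simps)
      then show "x \<in> C q" using mem by blast
    next
      fix x assume "x \<in> C q"
      then obtain \<beta> where "x = q + (\<beta> + \<beta>)" using mem by blast
      then have "x = p + ((\<alpha> + \<beta>) + (\<alpha> + \<beta>))" by (simp add: \<alpha> algebra_simps)
      then show "x \<in> C p" using mem by blast
    qed
  qed
  have self: "p \<in> C p" for p using C_eq by blast
  have card_C: "card (C p) = k" for p
    unfolding C_def k by (rule card_image) simp
  obtain ci where ci: "bij_betw ci (range C) {0..<r}"
    using ex_bij_betw_finite_nat[of "range C"] by (auto simp: r double_cosets_def C_def)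
  have "\<exists>h. bij_betw h (C p) {0..<k}" for p
    using ex_bij_betw_finite_nat[of "C p"] by (simp add: card_C)
  \<comment> \<open>The enumeration is indexed by the coset and not by a representative, so that all
    elements of one coset share it.\<close>
  then have "\<forall>B\<in>range C. \<exists>h. bij_betw h B {0..<k}" by blast
  then obtain J where J: "bij_betw (J B) B {0..<k}" if "B \<in> range C" for B
    by metis
  have ci_eq: "ci (C p) = ci (C q) \<longleftrightarrow> C p = C q" for p q
    using ci by (auto simp: bij_betw_def inj_on_def)
  have "coset_coordinates (\<lambda>p. ci (C p)) (\<lambda>p. J (C p) p) k r"
  proof
    show "ci (C p) < r" for p using bij_betwE[OF ci] by auto
    show "J (C p) p < k" for p using bij_betwE[OF J[of "C p"]] self by auto
    show "ci (C p) = ci (C q) \<longleftrightarrow> (\<exists>\<alpha>. q = p + (\<alpha> + \<alpha>))" for p q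
      by (simp add: ci_eq C_eq mem)
    show "p = q" if "ci (C p) = ci (C q)" "J (C p) p = J (C q) q" for p q
    proof -
      have "C p = C q" using that ci_eq by blast
      then show ?thesis
        using that J[of "C p"] self[of p] self[of q] by (auto simp: bij_betw_def inj_on_def)
    qed
    show "\<exists>p. ci (C p) = i \<and> J (C p) p = a" if "i < r" "a < k" for i a
    proof -
      obtain p where p: "ci (C p) = i"
        using bij_betw_imp_surj_on[OF ci] \<open>i < r\<close> by (metis atLeastLessThan_iff imageE le0)
      obtain q where q: "q \<in> C p" "J (C p) q = a"
        using bij_betw_imp_surj_on[OF J[of "C p"]] \<open>a < k\<close> by (metis atLeastLessThan_iff imageE le0 rangeI)
      then show ?thesis using p C_eq[of p q] by metis
    qed
  qed
  then show ?thesis by blast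
qed

text \<open>Simplicity is claimed outside the degenerate ranks: k = 1 gives the zero algebra, k = 2
  an abelian line, k = 4 two copies of type \<open>A\<^sub>1\<close>.\<close>

theorem proposition3p10:
  fixes k r :: nat
  assumes "k = card (double_subgroup :: 's::{finite,ab_group_add} set)"
    and "r = card (double_cosets :: 's set set)"
  shows "(odd k \<longrightarrow>
            lie_isomorphic (lie_quot (gS :: ('s \<times> 's) lie_term set lie) gS_ideal)
              (lie_copies r (type_B ((k - 1) div 2))) \<and>
            (k \<noteq> 1 \<longrightarrow> lie_simple (type_B ((k - 1) div 2)))) \<and>
         (even k \<longrightarrow>
            lie_isomorphic (lie_quot (gS :: ('s \<times> 's) lie_term set lie) gS_ideal)
              (lie_copies r (type_D (k div 2))) \<and>
            (k \<noteq> 2 \<and> k \<noteq> 4 \<longrightarrow> lie_simple (type_D (k div 2))))"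
proof -
  obtain c j :: "'s \<Rightarrow> nat" where "coset_coordinates c j k r"
    using coset_coordinates_exist[OF assms] by blast
  then have iso: "lie_isomorphic (lie_quot (gS :: ('s \<times> 's) lie_term set lie) gS_ideal) (lie_copies r (so k))"
    by (rule coset_coordinates.lie_quot_gS_isomorphic)
  \<comment> \<open>Excludes k = 0, which is even and different from 2 and 4.\<close>
  have "k > 0"
    using assms(1) by (simp add: double_subgroup_def card_gt_0_iff)
  have B: "type_B ((k - 1) div 2) = so k" if "odd k"
    using that by (auto simp: type_B_def elim!: oddE)
  have D: "type_D (k div 2) = so k" if "even k"
    using that by (simp add: type_D_def)
  have "k = 3 \<or> k \<ge> 5" if "odd k" "k \<noteq> 1"
    using that by presburger
  moreover have "k \<ge> 5" if "even k" "k \<noteq> 2" "k \<noteq> 4"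
    using that \<open>k > 0\<close> by presburger
  ultimately show ?thesis
    using iso B D lie_simple_so by metis
qed

end
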